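(* Assume (A1)–(A4) hold and that $\operatorname{dom} h$ has finite diameter $D_h>0$. Let $\lambda>0$ and an integer $K\ge1$ be given, let $(D,M)$ be a pair of positive reals (an estimate for the usually unknown pair $(D_h,\bar M)$), and consider SCPB1 with input $(\lambda,\theta,K)$ and constant $R$ given by $$\theta=\frac{2\lambda^2M^2}{D^2},\qquad R=\frac{D}{6M}.$$ Then, with $\kappa_D:=D_h^2/D^2$ and $\kappa_M:=\bar M^2/M^2$: (a) $$\mathbb{E}[\phi(\hat y_K^a)]-\phi_*\le\frac{3D^2}{2\lambda K}(\kappa_D+\kappa_M);$$ (b) the expected overall iteration complexity (the expected total number of iterations over all $K$ cycles) is, up to a logarithmic term, $$\mathcal{O}\left(\frac{\lambda^2M^2K^2}{D^2}+K\right),$$ i.e. it is bounded by an absolute constant times $\left(\frac{\lambda^2M^2K^2}{D^2}+K\right)\left(1+\ln_0^+\!\left(\frac{\lambda K}{R}\right)\right)$.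
   Context: Problem. $\xi$ is a random vector with support $\Xi$. Consider $\phi_*:=\min\{\phi(x):=f(x)+h(x): x\in\mathbb{R}^n\}$ with $f(x)=\mathbb{E}_\xi[F(x,\xi)]$. Here $\mathbb{R}^n$ has its Euclidean inner product $\langle\cdot,\cdot\rangle$ and norm $\|\cdot\|$. Assumptions. (A1) $f$ and $h$ are proper closed convex functions from $\mathbb{R}^n$ to $\mathbb{R}\cup\{+\infty\}$ with $\operatorname{dom} f\supset\operatorname{dom} h$. (A2) For almost every $\xi\in\Xi$ there are available a functional oracle $F(\cdot,\xi):\operatorname{dom} h\to\mathbb{R}$ and a stochastic subgradient oracle $s(\cdot,\xi):\operatorname{dom} h\to\mathbb{R}^n$ such that $f(x)=\mathbb{E}[F(x,\xi)]$ and $f'(x):=\mathbb{E}[s(x,\xi)]\in\partial f(x)$ for every $x\in\operatorname{dom} h$ ($F(\cdot,\xi)$ need not be convex). (A3) $\bar M:=\sup\{\mathbb{E}[\|s(x,\xi)\|^2]^{1/2}:x\in\operatorname{dom} h\}<\infty$. (A4) The set $X^*$ of optimal solutions is nonempty. SCPB scheme. Input: $\lambda,\theta>0$, integer $K\ge1$, $x_0\in\operatorname{dom} h$. Let $\tau=\theta K/(\theta K+1)$, $j_0=0$, and let $\xi_0,\xi_1,\dots$ be independent samples of $\xi$ (iteration $j$ draws $\xi_{j-1}$, independent of $\xi_0,\dots,\xi_{j-2}$). Iterations $j=1,2,\dots$ are grouped into $K$ consecutive cycles $\mathcal{C}_k=\{i_k,\dots,j_k\}$, $k=1,\dots,K$,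 where $i_k:=j_{k-1}+1$ and the integer $j_k\ge i_k$ is given by a cycle rule. For $j\in\mathcal{C}_k$: the prox-center is $x_j^c=x_{j_{k-1}}$; $S_j=s(x_{j_{k-1}},\xi_{j_{k-1}})$ if $j=i_k$ and $S_j=(1-\tau)s(x_{j-1},\xi_{j-1})+\tau S_{j-1}$ otherwise; $$x_j=\operatorname{argmin}_{u\in\mathbb{R}^n}\Big\{h(u)+\langle S_j,u\rangle+\tfrac1{2\lambda}\|u-x_j^c\|^2\Big\};$$ $y_j=x_j$ if $j=i_k$ and $y_j=(1-\tau)x_j+\tau y_{j-1}$ otherwise. Set $\hat y_k=y_{j_k}$. The output is $\hat y_K^a=\frac1{\lceil K/2\rceil}\sum_{k=\lfloor K/2\rfloor+1}^K\hat y_k$. SCPB1 (with constant $R>0$) is the SCPB scheme with the cycle rule: for every $k\ge1$, $j_k$ is the smallest integer $\ge i_k$ such that $\lambda k\,\tau^{j_k-i_k}\le R$. Notation: $\ln_0^+(\cdot)=\max\{0,\ln(\cdot)\}$. *)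

theory Defs
  imports "HOL-Probability.Probability"
begin

definition edom :: "('a \<Rightarrow> ereal) \<Rightarrow> 'a set" where
  "edom f = {x. f x < \<infinity>}"

(* The library's epigraph is restricted to real-valued functions. *)
definition eepigraph :: "('a \<Rightarrow> ereal) \<Rightarrow> ('a \<times> real) set" where
  "eepigraph f = {(x, t). f x \<le> ereal t}"

definition proper_closed_convex :: "('a::real_normed_vector \<Rightarrow> ereal) \<Rightarrow> bool" where
  "proper_closed_convex f \<longleftrightarrow>
     (\<forall>x. f x \<noteq> -\<infinity>) \<and> edom f \<noteq> {} \<and> closed (eepigraph f) \<and> convex (eepigraph f)"

definition subdifferential :: "('a::real_inner \<Rightarrow> ereal) \<Rightarrow> 'a \<Rightarrow> 'a set" where
  "subdifferential f x = {g. \<forall>y. f x + ereal (g \<bullet> (y - x)) \<le> f y}"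

definition optimal_value :: "('a \<Rightarrow> ereal) \<Rightarrow> ereal" where
  "optimal_value \<phi> = (INF x. \<phi> x)"

definition optimal_set :: "('a \<Rightarrow> ereal) \<Rightarrow> 'a set" where
  "optimal_set \<phi> = {x. is_arg_min \<phi> (\<lambda>_. True) x}"

(* Q is the law of the random vector.  All oracles are total functions; outside X (the effective
   domain of h) their values play no role.  The expectation identities come with integrability,
   because the Bochner integral of a non-integrable function is 0.  Joint measurability of s makes
   s evaluated at a random iterate and a fresh sample a random variable. *)
definition stochastic_oracles ::
  "'z measure \<Rightarrow> (real^'n \<Rightarrow> ereal) \<Rightarrow> (real^'n) set \<Rightarrow> (real^'n \<Rightarrow> 'z \<Rightarrow> real) \<Rightarrow>
   (real^'n \<Rightarrow> 'z \<Rightarrow> real^'n) \<Rightarrow> bool" where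
  "stochastic_oracles Q f X F s \<longleftrightarrow>
     (\<lambda>(x, z). s x z) \<in> borel_measurable (restrict_space borel X \<Otimes>\<^sub>M Q) \<and>
     (\<forall>x\<in>X. integrable Q (F x) \<and> f x = ereal (\<integral>z. F x z \<partial>Q) \<and>
            integrable Q (s x) \<and> (\<integral>z. s x z \<partial>Q) \<in> subdifferential f x)"

definition second_moment_bounded ::
  "'z measure \<Rightarrow> 'a set \<Rightarrow> ('a \<Rightarrow> 'z \<Rightarrow> 'b::real_normed_vector) \<Rightarrow> bool" where
  "second_moment_bounded Q X s \<longleftrightarrow>
     (\<forall>x\<in>X. integrable Q (\<lambda>z. (norm (s x z))\<^sup>2)) \<and>
     bdd_above ((\<lambda>x. sqrt (\<integral>z. (norm (s x z))\<^sup>2 \<partial>Q)) ` X)"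

(* Meaningful only under second_moment_bounded. *)
definition moment_bound ::
  "'z measure \<Rightarrow> 'a set \<Rightarrow> ('a \<Rightarrow> 'z \<Rightarrow> 'b::real_normed_vector) \<Rightarrow> real" where
  "moment_bound Q X s = (SUP x\<in>X. sqrt (\<integral>z. (norm (s x z))\<^sup>2 \<partial>Q))"

definition iid_samples :: "'w measure \<Rightarrow> (nat \<Rightarrow> 'w \<Rightarrow> 'z) \<Rightarrow> 'z measure \<Rightarrow> bool" where
  "iid_samples P \<xi> Q \<longleftrightarrow>
     prob_space.indep_vars P (\<lambda>_. Q) \<xi> UNIV \<and> (\<forall>j. distr P Q (\<xi> j) = Q)"

definition scpb_tau :: "real \<Rightarrow> nat \<Rightarrow> real" where
  "scpb_tau \<theta> K = \<theta> * real K / (\<theta> * real K + 1)"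

(* One realization of the scheme: z is the sample sequence, and the k-th cycle is
   {c (k - 1) + 1..c k}, so c k is the last iteration of that cycle. *)
definition scpb_run ::
  "(real^'n \<Rightarrow> ereal) \<Rightarrow> (real^'n \<Rightarrow> 'z \<Rightarrow> real^'n) \<Rightarrow> real \<Rightarrow> real \<Rightarrow> nat \<Rightarrow> real^'n \<Rightarrow>
   (nat \<Rightarrow> 'z) \<Rightarrow> (nat \<Rightarrow> nat) \<Rightarrow> (nat \<Rightarrow> real^'n) \<Rightarrow> (nat \<Rightarrow> real^'n) \<Rightarrow> (nat \<Rightarrow> real^'n) \<Rightarrow> bool"
where
  "scpb_run h s lam \<theta> K x0 z c S x y \<longleftrightarrow>
     x 0 = x0 \<and> c 0 = 0 \<and>
     (\<forall>k\<in>{1..K}. let \<tau> = scpb_tau \<theta> K; i = c (k - 1) + 1; xc = x (c (k - 1)) in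
        i \<le> c k \<and>
        (\<forall>j\<in>{i..c k}.
           S j = (if j = i then s (x (c (k - 1))) (z (c (k - 1)))
                  else (1 - \<tau>) *\<^sub>R s (x (j - 1)) (z (j - 1)) + \<tau> *\<^sub>R S (j - 1)) \<and>
           is_arg_min
             (\<lambda>u. h u + ereal (S j \<bullet> u) + ereal (1 / (2 * lam) * (norm (u - xc))\<^sup>2))
             (\<lambda>_. True) (x j) \<and>
           y j = (if j = i then x j else (1 - \<tau>) *\<^sub>R x j + \<tau> *\<^sub>R y (j - 1))))"

definition scpb1_cycle_rule :: "real \<Rightarrow> real \<Rightarrow> nat \<Rightarrow> real \<Rightarrow> (nat \<Rightarrow> nat) \<Rightarrow> bool" where
  "scpb1_cycle_rule lam \<theta> K R c \<longleftrightarrow>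
     (\<forall>k\<in>{1..K}. let i = c (k - 1) + 1 in
        c k = (LEAST j. i \<le> j \<and> lam * real k * scpb_tau \<theta> K ^ (j - i) \<le> R))"

definition scpb_output :: "nat \<Rightarrow> (nat \<Rightarrow> nat) \<Rightarrow> (nat \<Rightarrow> real^'n) \<Rightarrow> real^'n" where
  "scpb_output K c y =
     (1 / real_of_int \<lceil>real K / 2\<rceil>) *\<^sub>R (\<Sum>k = K div 2 + 1..K. y (c k))"

definition ln0p :: "real \<Rightarrow> real" where
  "ln0p t = max 0 (ln t)"

end

theory Submission
  imports Defs
begin

text \<open>The cycle lengths do not depend on the samples, so part (b) is a deterministic estimate based on
  \<open>- ln \<tau> \<ge> 1 - \<tau> = 1 / (\<theta> K + 1)\<close>.  For part (a), within a cycle the gap between \<open>\<phi>\<close> at the averaged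
  iterate \<open>y\<^sub>j\<close> and the optimal value of the \<open>j\<close>-th subproblem contracts by \<open>\<tau>\<close> per iteration, up to an
  error \<open>(1 - \<tau>)\<^sup>2 lam (B + \<parallel>s\<^sub>j\<parallel>)\<^sup>2 / (2 \<tau>)\<close>, where \<open>B\<^sup>2\<close> bounds the second moments of the oracle and hence \<open>B\<close>
  is a Lipschitz constant of \<open>f\<close> on the domain of \<open>h\<close>.  Comparing the subproblem value with its
  model at a minimizer \<open>x\<^sup>*\<close> gives a bound that holds for every sample path, whose distance terms
  telescope over the cycles.  Expectations are taken only then: the \<open>j\<close>-th iterate depends on
  the first \<open>j\<close> samples only, so the linearization of \<open>f\<close> drawn there has expected value at most \<open>f x\<^sup>*\<close>
  at \<open>x\<^sup>*\<close>.\<close>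

section \<open>The proximal step and the estimate for one cycle\<close>

text \<open>Unrolled, \<open>a 0\<close> has weight \<open>\<tau> ^ m\<close> and \<open>a l\<close>
  has weight \<open>(1 - \<tau>) * \<tau> ^ (m - l)\<close> for \<open>1 \<le> l \<le> m\<close>,
  and the weights sum to one. This is the recursion for both the aggregated subgradients and the
  averaged iterates of a cycle, with index 0 at its start.\<close>

primrec geo_avg :: "real \<Rightarrow> (nat \<Rightarrow> 'a::real_vector) \<Rightarrow> nat \<Rightarrow> 'a" where
  "geo_avg \<tau> a 0 = a 0"
| "geo_avg \<tau> a (Suc m) = (1 - \<tau>) *\<^sub>R a (Suc m) + \<tau> *\<^sub>R geo_avg \<tau> a m"

lemma geo_avg_add: "geo_avg \<tau> (\<lambda>l. a l + b l) m = geo_avg \<tau> a m + geo_avg \<tau> b m"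
  by (induction m) (simp_all add: scaleR_add_right)

lemma geo_avg_const: "geo_avg \<tau> (\<lambda>_. v) m = v"
  by (induction m) (simp_all flip: scaleR_add_left)

lemma geo_avg_inner: "geo_avg \<tau> a m \<bullet> v = geo_avg \<tau> (\<lambda>l. a l \<bullet> v) m"
  by (induction m) (simp_all add: inner_add_left)

lemma geo_avg_mono:
  fixes a b :: "nat \<Rightarrow> real"
  assumes "0 \<le> \<tau>" "\<tau> \<le> 1" "\<And>l. l \<le> m \<Longrightarrow> a l \<le> b l"
  shows "geo_avg \<tau> a m \<le> geo_avg \<tau> b m"
  using assms(3)
proof (induction m)
  case (Suc m)
  then show ?case using assms(1,2)
    by (auto intro!: add_mono mult_left_mono)
qed simp

lemma geo_avg_mem_convex:
  assumes "0 \<le> \<tau>" "\<tau> \<le> 1" "convex C" "\<And>l. l \<le> m \<Longrightarrow> a l \<in> C"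
  shows "geo_avg \<tau> a m \<in> C"
  using assms(4)
proof (induction m)
  case (Suc m)
  then show ?case using assms(1-3) by (auto intro: convexD)
qed simp

lemma convex_on_geo_avg:
  assumes "0 \<le> \<tau>" "\<tau> \<le> 1" "convex_on C g" "\<And>l. l \<le> m \<Longrightarrow> a l \<in> C"
  shows "g (geo_avg \<tau> a m) \<le> geo_avg \<tau> (\<lambda>l. g (a l)) m"
  using assms(4)
proof (induction m)
  case (Suc m)
  have "geo_avg \<tau> a m \<in> C"
    using assms(1-3) Suc.prems by (intro geo_avg_mem_convex) (auto dest: convex_on_imp_convex)
  then have "g (geo_avg \<tau> a (Suc m)) \<le> (1 - \<tau>) * g (a (Suc m)) + \<tau> * g (geo_avg \<tau> a m)"
    using convex_onD[OF assms(3), of \<tau>] assms(1,2) Suc.prems by auto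
  also have "\<dots> \<le> geo_avg \<tau> (\<lambda>l. g (a l)) (Suc m)"
    using Suc assms(1) by (auto intro!: mult_left_mono)
  finally show ?case .
qed simp

lemma integrable_geo_avg:
  fixes a :: "nat \<Rightarrow> 'a \<Rightarrow> real"
  assumes "\<And>l. l \<le> m \<Longrightarrow> integrable M (a l)"
  shows "integrable M (\<lambda>w. geo_avg \<tau> (\<lambda>l. a l w) m)"
  using assms by (induction m) auto

lemma integral_geo_avg:
  fixes a :: "nat \<Rightarrow> 'a \<Rightarrow> real"
  assumes "\<And>l. l \<le> m \<Longrightarrow> integrable M (a l)"
  shows "(\<integral>w. geo_avg \<tau> (\<lambda>l. a l w) m \<partial>M) = geo_avg \<tau> (\<lambda>l. \<integral>w. a l w \<partial>M) m"
  using assms by (induction m) (simp_all add: integrable_geo_avg)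

lemma borel_measurable_geo_avg:
  fixes a :: "nat \<Rightarrow> 'a \<Rightarrow> 'b::euclidean_space"
  assumes "\<And>l. l \<le> m \<Longrightarrow> a l \<in> borel_measurable M"
  shows "(\<lambda>w. geo_avg \<tau> (\<lambda>l. a l w) m) \<in> borel_measurable M"
  using assms by (induction m) auto

section \<open>Strong convexity and nonexpansiveness of the proximal step\<close>

lemma norm_convex_combination_sq:
  fixes x u v :: "'a::real_inner"
  shows "(norm ((1 - t) *\<^sub>R x + t *\<^sub>R u - v))\<^sup>2
    = (1 - t) * (norm (x - v))\<^sup>2 + t * (norm (u - v))\<^sup>2 - t * (1 - t) * (norm (u - x))\<^sup>2"
  unfolding power2_norm_eq_inner
  by (simp add: inner_add_left inner_add_right inner_diff_left inner_diff_right inner_commute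
      algebra_simps)

text \<open>The quadratic makes the objective strongly convex. Comparing the minimizer with the
  points of the segment towards \<open>u\<close>, dividing by the segment parameter \<open>t\<close>
  and letting \<open>t\<close> tend to 0 leaves the full term in \<open>u - x\<close>.\<close>

lemma prox_three_point:
  fixes x u v S :: "'a::real_inner" and g :: "'a \<Rightarrow> real"
  assumes g: "convex_on C g" and "0 \<le> k" and "x \<in> C" "u \<in> C"
    and min: "\<And>w. w \<in> C \<Longrightarrow> g x + S \<bullet> x + k * (norm (x - v))\<^sup>2 \<le> g w + S \<bullet> w + k * (norm (w - v))\<^sup>2"
  shows "g x + S \<bullet> x + k * (norm (x - v))\<^sup>2 + k * (norm (u - x))\<^sup>2 \<le> g u + S \<bullet> u + k * (norm (u - v))\<^sup>2"
proof -
  define q where "q w = g w + S \<bullet> w + k * (norm (w - v))\<^sup>2" for w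
  have "q x + (1 - t) * (k * (norm (u - x))\<^sup>2) \<le> q u" if t: "0 < t" "t < 1" for t
  proof -
    let ?w = "(1 - t) *\<^sub>R x + t *\<^sub>R u"
    have "?w \<in> C" using assms t by (intro convexD) (auto dest: convex_on_imp_convex)
    then have "q x \<le> q ?w" using min by (simp add: q_def)
    also have "\<dots> \<le> (1 - t) * q x + t * q u - t * ((1 - t) * (k * (norm (u - x))\<^sup>2))"
      using convex_onD[OF g, of t x u] t assms(3,4)
      unfolding q_def norm_convex_combination_sq by (simp add: inner_add_right algebra_simps)
    finally have "t * (q x + (1 - t) * (k * (norm (u - x))\<^sup>2) - q u) \<le> 0"
      by (simp add: algebra_simps)
    then show ?thesis using t by (simp add: mult_le_0_iff)
  qed
  then have "\<forall>\<^sub>F t in at_right 0. q x + (1 - t) * (k * (norm (u - x))\<^sup>2) \<le> q u"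
    unfolding eventually_at_right_field by (intro exI[of _ 1]) auto
  moreover have "((\<lambda>t. q x + (1 - t) * (k * (norm (u - x))\<^sup>2)) \<longlongrightarrow> q x + (1 - 0) * (k * (norm (u - x))\<^sup>2)) (at_right 0)"
    by (intro tendsto_intros)
  ultimately have "q x + (1 - 0) * (k * (norm (u - x))\<^sup>2) \<le> q u"
    by (intro tendsto_upperbound) auto
  then show ?thesis by (simp add: q_def)
qed

text \<open>The step with center \<open>v\<close> and slope \<open>S\<close> is the proximal map of
  \<open>lam * g\<close> at \<open>v - lam *\<^sub>R S\<close>. Adding the two three-point
  inequalities, each tested at the other minimizer, and applying Cauchy-Schwarz gives
  nonexpansiveness, which later yields measurability of the iterates.\<close>

lemma prox_nonexpansive:
  fixes x x' v v' S S' :: "'a::real_inner" and g :: "'a \<Rightarrow> real"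
  assumes "lam > 0" "x \<in> C" "x' \<in> C"
    and "\<And>u. u \<in> C \<Longrightarrow> g x + S \<bullet> x + 1 / (2 * lam) * (norm (x - v))\<^sup>2 + 1 / (2 * lam) * (norm (u - x))\<^sup>2
           \<le> g u + S \<bullet> u + 1 / (2 * lam) * (norm (u - v))\<^sup>2"
    and "\<And>u. u \<in> C \<Longrightarrow> g x' + S' \<bullet> x' + 1 / (2 * lam) * (norm (x' - v'))\<^sup>2 + 1 / (2 * lam) * (norm (u - x'))\<^sup>2
           \<le> g u + S' \<bullet> u + 1 / (2 * lam) * (norm (u - v'))\<^sup>2"
  shows "norm (x - x') \<le> norm ((v - lam *\<^sub>R S) - (v' - lam *\<^sub>R S'))"
proof -
  define k where "k = 1 / (2 * lam)"
  have "k * (norm (x - v))\<^sup>2 + k * (norm (x' - x))\<^sup>2 + k * (norm (x' - v'))\<^sup>2 + k * (norm (x - x'))\<^sup>2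
     \<le> (S - S') \<bullet> (x' - x) + k * (norm (x' - v))\<^sup>2 + k * (norm (x - v'))\<^sup>2"
    using assms(4)[OF assms(3)] assms(5)[OF assms(2)]
    by (simp add: k_def inner_diff_left inner_diff_right)
  moreover have "(norm (x' - v))\<^sup>2 + (norm (x - v'))\<^sup>2 - (norm (x - v))\<^sup>2 - (norm (x' - v'))\<^sup>2
     = 2 * ((x - x') \<bullet> (v - v'))"
    unfolding power2_norm_eq_inner
    by (simp add: inner_diff_left inner_diff_right inner_commute algebra_simps)
  then have "k * (norm (x' - v))\<^sup>2 + k * (norm (x - v'))\<^sup>2
      = k * (norm (x - v))\<^sup>2 + k * (norm (x' - v'))\<^sup>2 + k * (2 * ((x - x') \<bullet> (v - v')))"
    by (simp add: distrib_left[symmetric])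
  ultimately have *: "k * (2 * (norm (x - x'))\<^sup>2) \<le> (S - S') \<bullet> (x' - x) + k * (2 * ((x - x') \<bullet> (v - v')))"
    by (simp add: norm_minus_commute[of x' x])
  have "(norm (x - x'))\<^sup>2 = lam * (k * (2 * (norm (x - x'))\<^sup>2))"
    using assms(1) by (simp add: k_def)
  also have "\<dots> \<le> lam * ((S - S') \<bullet> (x' - x) + k * (2 * ((x - x') \<bullet> (v - v'))))"
    using * assms(1) by (intro mult_left_mono) auto
  also have "\<dots> = (x - x') \<bullet> ((v - lam *\<^sub>R S) - (v' - lam *\<^sub>R S'))"
    using assms(1) by (simp add: k_def inner_diff_left inner_diff_right inner_add_right inner_commute field_simps)
  also have "\<dots> \<le> norm (x - x') * norm ((v - lam *\<^sub>R S) - (v' - lam *\<^sub>R S'))"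
    by (rule norm_cauchy_schwarz)
  finally show ?thesis
    by (cases "x = x'") (auto simp: power2_eq_square)
qed

text \<open>Applied to the proximal step: \<open>x\<close> is a continuous function of \<open>p\<close> on the range of \<open>p\<close>, which
  need not be measurable, so the proximal map never has to be shown to be everywhere defined.\<close>
lemma borel_measurable_of_nonexpansive:
  fixes p :: "'w \<Rightarrow> 'a::real_normed_vector" and x :: "'w \<Rightarrow> 'b::real_normed_vector"
  assumes p: "p \<in> borel_measurable N"
    and le: "\<And>w w'. w \<in> space N \<Longrightarrow> w' \<in> space N \<Longrightarrow> norm (x w - x w') \<le> norm (p w - p w')"
  shows "x \<in> borel_measurable N"
proof -
  define A where "A = p ` space N"
  \<comment> \<open>The choice of \<open>w\<close> is immaterial: equal values of \<open>p\<close>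
    force equal values of \<open>x\<close> by \<open>le\<close>, so \<open>g\<close> recovers
    \<open>x\<close> from \<open>p\<close>.\<close>
  define g where "g a = x (SOME w. w \<in> space N \<and> p w = a)" for a
  have g: "\<exists>w\<in>space N. p w = a \<and> g a = x w" if "a \<in> A" for a
  proof -
    have "\<exists>w. w \<in> space N \<and> p w = a" using that by (auto simp: A_def)
    from someI_ex[OF this] show ?thesis by (auto simp: g_def)
  qed
  have "1-lipschitz_on A g"
    unfolding lipschitz_on_def dist_norm by (metis g le mult_1 zero_le_one)
  then have "g \<in> borel_measurable (restrict_space borel A)"
    by (intro borel_measurable_continuous_on_restrict lipschitz_on_continuous_on)
  moreover have "p \<in> measurable N (restrict_space borel A)"
    using p by (intro measurable_restrict_space2) (auto simp: A_def)
  ultimately have "(\<lambda>w. g (p w)) \<in> borel_measurable N"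
    by (rule measurable_compose[rotated])
  moreover have "g (p w) = x w" if w: "w \<in> space N" for w
  proof -
    obtain w' where "w' \<in> space N" "p w' = p w" "g (p w) = x w'"
      using g[of "p w"] w by (auto simp: A_def)
    then show ?thesis using le[of w w'] w by simp
  qed
  ultimately show ?thesis by (simp cong: measurable_cong)
qed

text \<open>Completing the square in \<open>d\<close>. In a cycle \<open>d\<close> is the distance
  of consecutive iterates: the linear term is the error of the new cut, the quadratic one comes from
  strong convexity.\<close>

lemma linear_minus_quadratic_le:
  fixes a d lam \<tau> :: real
  assumes "0 < \<tau>" "0 < lam"
  shows "(1 - \<tau>) * (a * d) - \<tau> * (d\<^sup>2 / (2 * lam)) \<le> (1 - \<tau>) * ((1 - \<tau>) * lam * a\<^sup>2 / (2 * \<tau>))"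
proof -
  have "0 \<le> (\<tau> * d - (1 - \<tau>) * lam * a)\<^sup>2 / (2 * lam * \<tau>)" using assms by simp
  also have "\<dots> = (1 - \<tau>) * ((1 - \<tau>) * lam * a\<^sup>2 / (2 * \<tau>)) - ((1 - \<tau>) * (a * d) - \<tau> * (d\<^sup>2 / (2 * lam)))"
    using assms by (simp add: field_simps power2_eq_square)
  finally show ?thesis by simp
qed

text \<open>Induction over a cycle with the model value
  \<open>mm l = min (\<Gamma>\<^sub>l + \<parallel>\<cdot> - x 0\<parallel>\<^sup>2 / (2 * lam))\<close>, where \<open>\<Gamma>\<^sub>l = V l + \<langle>S l, \<cdot>\<rangle> + h\<close> is the aggregated
  cut: the strong convexity of the subproblem pays for the error of each new linearization.\<close>
lemma cycle_estimate:
  fixes f h :: "'a::real_inner \<Rightarrow> real" and x \<sigma> :: "nat \<Rightarrow> 'a" and xs :: 'a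
  assumes f: "convex_on C f" and h: "convex_on C h"
    and \<tau>: "0 < \<tau>" "\<tau> \<le> 1" and lam: "0 < lam" and B: "0 \<le> B"
    and lip: "\<And>u v. u \<in> C \<Longrightarrow> v \<in> C \<Longrightarrow> f u - f v \<le> B * norm (u - v)"
    and diam: "\<And>u v. u \<in> C \<Longrightarrow> v \<in> C \<Longrightarrow> norm (u - v) \<le> d"
    and x: "\<And>l. l \<le> Suc m \<Longrightarrow> x l \<in> C" and xs: "xs \<in> C"
    and three: "\<And>l u. l \<le> m \<Longrightarrow> u \<in> C \<Longrightarrow>
        h (x (Suc l)) + geo_avg \<tau> \<sigma> l \<bullet> x (Suc l) + 1 / (2 * lam) * (norm (x (Suc l) - x 0))\<^sup>2
          + 1 / (2 * lam) * (norm (u - x (Suc l)))\<^sup>2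
        \<le> h u + geo_avg \<tau> \<sigma> l \<bullet> u + 1 / (2 * lam) * (norm (u - x 0))\<^sup>2"
  shows "f (geo_avg \<tau> (\<lambda>l. x (Suc l)) m) + h (geo_avg \<tau> (\<lambda>l. x (Suc l)) m) - (f xs + h xs)
    \<le> ((norm (xs - x 0))\<^sup>2 - (norm (xs - x (Suc m)))\<^sup>2) / (2 * lam)
      + geo_avg \<tau> (\<lambda>l. f (x l) + \<sigma> l \<bullet> (xs - x l) - f xs) m
      + \<tau> ^ m * ((B + norm (\<sigma> 0)) * d)
      + geo_avg \<tau> (\<lambda>l. (1 - \<tau>) * lam * (B + norm (\<sigma> l))\<^sup>2 / (2 * \<tau>)) m"
proof -
  define V where "V l = geo_avg \<tau> (\<lambda>l. f (x l) - \<sigma> l \<bullet> x l) l" for l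
  define S where "S l = geo_avg \<tau> \<sigma> l" for l
  define b where "b l = (1 - \<tau>) * lam * (B + norm (\<sigma> l))\<^sup>2 / (2 * \<tau>)" for l
  define mm where "mm l = V l + S l \<bullet> x (Suc l) + h (x (Suc l)) + (norm (x (Suc l) - x 0))\<^sup>2 / (2 * lam)" for l
  \<comment> \<open>Averaged objective values are tracked instead of the value at the averaged
    point, because they obey an exact recursion; convexity passes to the averaged point at the very
    end.\<close>
  define Y where "Y l = geo_avg \<tau> (\<lambda>l. f (x (Suc l)) + h (x (Suc l))) l" for l
  have three': "h (x (Suc l)) + S l \<bullet> x (Suc l) + (norm (x (Suc l) - x 0))\<^sup>2 / (2 * lam)
          + (norm (u - x (Suc l)))\<^sup>2 / (2 * lam)
        \<le> h u + S l \<bullet> u + (norm (u - x 0))\<^sup>2 / (2 * lam)" if "l \<le> m" "u \<in> C" for l u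
    using three[OF that] by (simp add: S_def)
  \<comment> \<open>A Lipschitz bound replaces smoothness, so the linearization error is only linear
    in the distance, with no variance reduction.\<close>
  have grad: "f q - f p - \<sigma> l \<bullet> (q - p) \<le> (B + norm (\<sigma> l)) * norm (q - p)"
    if "p \<in> C" "q \<in> C" for p q l
    using lip[OF that(2,1)] norm_cauchy_schwarz[of "- \<sigma> l" "q - p"] by (simp add: algebra_simps)
  have b0: "0 \<le> b l" for l using \<tau> lam by (simp add: b_def)
  have gap: "Y l - mm l \<le> \<tau> ^ l * ((B + norm (\<sigma> 0)) * d) + geo_avg \<tau> b l" if "l \<le> m" for l
    using that
  proof (induction l)
    case 0
    have "Y 0 - mm 0 = f (x 1) - f (x 0) - \<sigma> 0 \<bullet> (x 1 - x 0) - (norm (x 1 - x 0))\<^sup>2 / (2 * lam)"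
      by (simp add: Y_def mm_def V_def S_def inner_diff_right)
    \<comment> \<open>The first iteration has no earlier gap to contract: its quadratic term is
      dropped and the diameter bounds the rest. This is the source of the \<open>\<tau> ^ m\<close>
      term.\<close>
    also have "\<dots> \<le> (B + norm (\<sigma> 0)) * norm (x 1 - x 0)"
    proof -
      have "x 0 \<in> C" "x 1 \<in> C" using x by auto
      moreover have "0 \<le> (norm (x 1 - x 0))\<^sup>2 / (2 * lam)" using lam by simp
      ultimately show ?thesis using grad[of "x 0" "x 1" 0] by linarith
    qed
    also have "\<dots> \<le> (B + norm (\<sigma> 0)) * d"
      using B diam x[of 0] x[of 1] by (intro mult_left_mono) auto
    finally show ?case using b0[of 0] by simp
  next
    case (Suc l)
    define p where "p = x (Suc l)"
    define q where "q = x (Suc (Suc l))"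
    define s where "s = \<sigma> (Suc l)"
    have pq: "p \<in> C" "q \<in> C" using Suc.prems x by (auto simp: p_def q_def)
    \<comment> \<open>\<open>mm (Suc l)\<close> is \<open>\<tau>\<close> times the old model at
      \<open>q\<close> plus \<open>1 - \<tau>\<close> times the new cut with \<open>h\<close> and
      the quadratic at \<open>q\<close>. The first share is bounded below by strong convexity around
      \<open>p\<close>; in the second the quadratic is dropped.\<close>
    have "\<tau> * (h p + S l \<bullet> p + (norm (p - x 0))\<^sup>2 / (2 * lam) + (norm (q - p))\<^sup>2 / (2 * lam))
        \<le> \<tau> * (h q + S l \<bullet> q + (norm (q - x 0))\<^sup>2 / (2 * lam))"
      using three'[of l q] Suc.prems pq \<tau> by (intro mult_left_mono) (auto simp: p_def)
    moreover have "0 \<le> (1 - \<tau>) * ((norm (q - x 0))\<^sup>2 / (2 * lam))" using \<tau> lam by simp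
    ultimately have "\<tau> * (mm l + (norm (q - p))\<^sup>2 / (2 * lam)) + (1 - \<tau>) * (f p + s \<bullet> (q - p) + h q) \<le> mm (Suc l)"
      by (simp add: mm_def V_def S_def p_def[symmetric] q_def[symmetric] s_def[symmetric]
          inner_add_left inner_diff_right algebra_simps add_divide_distrib diff_divide_distrib)
    moreover have "Y (Suc l) = (1 - \<tau>) * (f q + h q) + \<tau> * Y l"
      by (simp add: Y_def q_def)
    ultimately have "Y (Suc l) - mm (Suc l) \<le> \<tau> * (Y l - mm l)
        + (1 - \<tau>) * (f q - f p - s \<bullet> (q - p)) - \<tau> * ((norm (q - p))\<^sup>2 / (2 * lam))"
      by (simp add: algebra_simps)
    also have "\<dots> \<le> \<tau> * (\<tau> ^ l * ((B + norm (\<sigma> 0)) * d) + geo_avg \<tau> b l)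
        + (1 - \<tau>) * ((B + norm s) * norm (q - p)) - \<tau> * ((norm (q - p))\<^sup>2 / (2 * lam))"
      using Suc grad[OF pq, of "Suc l"] \<tau> by (intro diff_mono add_mono mult_left_mono) (auto simp: s_def)
    also have "\<dots> \<le> \<tau> * (\<tau> ^ l * ((B + norm (\<sigma> 0)) * d) + geo_avg \<tau> b l) + (1 - \<tau>) * b (Suc l)"
      using linear_minus_quadratic_le[OF \<tau>(1) lam, of "B + norm s" "norm (q - p)"]
      by (simp add: b_def s_def)
    finally show ?case by (simp add: algebra_simps)
  qed
  \<comment> \<open>At \<open>xs\<close> the aggregated cut is an average of sampled linearizations.
    Their deviation from \<open>f xs\<close> has no sign on a single path, so it is kept until
    expectations are taken.\<close>
  have "V m + S m \<bullet> xs = geo_avg \<tau> (\<lambda>l. (f (x l) - \<sigma> l \<bullet> x l) + \<sigma> l \<bullet> xs) m"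
    by (simp add: V_def S_def geo_avg_inner geo_avg_add)
  also have "\<dots> = geo_avg \<tau> (\<lambda>l. (f (x l) + \<sigma> l \<bullet> (xs - x l) - f xs) + f xs) m"
    by (simp add: inner_diff_right algebra_simps)
  also have "\<dots> = geo_avg \<tau> (\<lambda>l. f (x l) + \<sigma> l \<bullet> (xs - x l) - f xs) m + f xs"
    by (simp only: geo_avg_add geo_avg_const)
  \<comment> \<open>The three-point inequality at \<open>u = xs\<close> produces the difference of
    squared distances that telescopes over the cycles.\<close>
  finally have "mm m \<le> geo_avg \<tau> (\<lambda>l. f (x l) + \<sigma> l \<bullet> (xs - x l) - f xs) m + f xs + h xs
      + ((norm (xs - x 0))\<^sup>2 - (norm (xs - x (Suc m)))\<^sup>2) / (2 * lam)"
    using three'[of m xs] xs by (simp add: mm_def diff_divide_distrib)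
  moreover have "f (geo_avg \<tau> (\<lambda>l. x (Suc l)) m) + h (geo_avg \<tau> (\<lambda>l. x (Suc l)) m) \<le> Y m"
    unfolding Y_def using \<tau> x by (intro convex_on_geo_avg[OF _ _ convex_on_add[OF f h]]) auto
  ultimately show ?thesis using gap[of m] unfolding b_def by simp
qed

section \<open>Extended-valued convex functions as real functions on their domain\<close>

lemma real_of_ereal_fin:
  assumes "proper_closed_convex f" "u \<in> edom f"
  shows "f u = ereal (real_of_ereal (f u))"
  using assms by (cases "f u") (auto simp: proper_closed_convex_def edom_def)

lemma convex_on_real_of_ereal:
  assumes "proper_closed_convex f"
  shows "convex_on (edom f) (\<lambda>u. real_of_ereal (f u))"
proof -
  note fin = real_of_ereal_fin[OF assms]
  \<comment> \<open>The inequality is proved for extended values first, since it yields both the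
    convexity of the domain and, once finiteness is known, the real inequality.\<close>
  have *: "f ((1 - t) *\<^sub>R u + t *\<^sub>R v) \<le> ereal ((1 - t) * real_of_ereal (f u) + t * real_of_ereal (f v))"
    if "u \<in> edom f" "v \<in> edom f" "0 \<le> t" "t \<le> 1" for u v t
  proof -
    have "(u, real_of_ereal (f u)) \<in> eepigraph f" "(v, real_of_ereal (f v)) \<in> eepigraph f"
      using fin that by (auto simp: eepigraph_def)
    then have "(1 - t) *\<^sub>R (u, real_of_ereal (f u)) + t *\<^sub>R (v, real_of_ereal (f v)) \<in> eepigraph f"
      using assms that by (intro convexD) (auto simp: proper_closed_convex_def)
    then show ?thesis by (simp add: eepigraph_def)
  qed
  have conv: "convex (edom f)"
  proof (rule convexI)
    fix u v and a t :: real
    assume A: "u \<in> edom f" "v \<in> edom f" "0 \<le> a" "0 \<le> t" "a + t = 1"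
    then have "a = 1 - t" by simp
    have "f (a *\<^sub>R u + t *\<^sub>R v) < \<infinity>"
      unfolding \<open>a = 1 - t\<close> by (rule le_less_trans[OF *]) (use A in auto)
    then show "a *\<^sub>R u + t *\<^sub>R v \<in> edom f" by (simp add: edom_def)
  qed
  show ?thesis
  proof (rule convex_onI[OF _ conv])
    fix t u v assume A: "0 < t" "t < (1::real)" "u \<in> edom f" "v \<in> edom f"
    then have "(1 - t) *\<^sub>R u + t *\<^sub>R v \<in> edom f" using conv by (auto intro: convexD)
    from fin[OF this] *[of u v t] A
    show "real_of_ereal (f ((1 - t) *\<^sub>R u + t *\<^sub>R v))
        \<le> (1 - t) * real_of_ereal (f u) + t * real_of_ereal (f v)"
      by (metis ereal_less_eq(3) less_imp_le)
  qed
qed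

text \<open>A sublevel set at a real height is a slice of the closed epigraph, hence closed; the one
  at \<open>-\<infinity>\<close> is a countable intersection of such slices.\<close>

lemma borel_measurable_closed_epigraph:
  fixes f :: "'a::real_normed_vector \<Rightarrow> ereal"
  assumes "closed (eepigraph f)"
  shows "f \<in> borel_measurable borel"
  unfolding borel_measurable_iff_Iic_ereal
proof
  fix a :: ereal
  have real: "{u. f u \<le> ereal r} \<in> sets borel" for r
  proof -
    have "closed ((\<lambda>u. (u, r)) -` eepigraph f)"
      using assms by (intro closed_vimage continuous_intros)
    then show ?thesis by (simp add: eepigraph_def vimage_def)
  qed
  have "{u. f u \<le> a} \<in> sets borel"
  proof (cases a)
    case MInf
    have "f u \<le> -\<infinity> \<longleftrightarrow> (\<forall>n::nat. f u \<le> ereal (- real n))" for u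
    proof (cases "f u")
      case (real r)
      obtain n :: nat where "- r < real n" using reals_Archimedean2 by blast
      then have "\<not> r \<le> - real n" by simp
      then show ?thesis using real by auto
    qed auto
    then have "{u. f u \<le> a} = (\<Inter>n::nat. {u. f u \<le> ereal (- real n)})" by (auto simp: MInf)
    then show ?thesis using real by auto
  qed (use real in auto)
  then show "f -` {..a} \<inter> space borel \<in> sets borel" by (simp add: vimage_def)
qed

section \<open>Evaluating an oracle at an independent sample\<close>

(* The library's indep_var only relates random variables with values in the same type. *)
definition independent_sample ::
  "'w measure \<Rightarrow> 'b measure \<Rightarrow> ('w \<Rightarrow> 'b) \<Rightarrow> 'z measure \<Rightarrow> ('w \<Rightarrow> 'z) \<Rightarrow> bool" where
  "independent_sample M A a Q \<zeta> \<longleftrightarrow> a \<in> measurable M A \<and> \<zeta> \<in> measurable M Q \<and> distr M Q \<zeta> = Q \<and>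
     distr M (A \<Otimes>\<^sub>M Q) (\<lambda>w. (a w, \<zeta> w)) = distr M A a \<Otimes>\<^sub>M Q"

lemma independent_sampleD:
  assumes "independent_sample M A a Q \<zeta>"
  shows "a \<in> measurable M A" "\<zeta> \<in> measurable M Q" "distr M Q \<zeta> = Q"
    "distr M (A \<Otimes>\<^sub>M Q) (\<lambda>w. (a w, \<zeta> w)) = distr M A a \<Otimes>\<^sub>M Q"
  using assms by (auto simp: independent_sample_def)

text \<open>Tonelli on the product law. Being free of integrability conditions, it is the form with
  which square integrability is established.\<close>

lemma (in prob_space) nn_integral_independent_sample:
  assumes ind: "independent_sample M A a Q \<zeta>" and g: "g \<in> borel_measurable (A \<Otimes>\<^sub>M Q)"
  shows "(\<integral>\<^sup>+w. g (a w, \<zeta> w) \<partial>M) = (\<integral>\<^sup>+w. \<integral>\<^sup>+z. g (a w, z) \<partial>Q \<partial>M)"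
proof -
  have [measurable]: "random_variable A a" "random_variable Q \<zeta>"
    using independent_sampleD[OF ind] by auto
  interpret Q: prob_space Q using prob_space_distr[of \<zeta> Q] independent_sampleD[OF ind] by simp
  note g[measurable]
  have "(\<integral>\<^sup>+w. g (a w, \<zeta> w) \<partial>M) = (\<integral>\<^sup>+p. g p \<partial>distr M (A \<Otimes>\<^sub>M Q) (\<lambda>w. (a w, \<zeta> w)))"
    by (subst nn_integral_distr) auto
  also have "\<dots> = (\<integral>\<^sup>+v. \<integral>\<^sup>+z. g (v, z) \<partial>Q \<partial>distr M A a)"
    unfolding independent_sampleD(4)[OF ind] by (subst Q.nn_integral_fst) auto
  also have "\<dots> = (\<integral>\<^sup>+w. \<integral>\<^sup>+z. g (a w, z) \<partial>Q \<partial>M)"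
    by (subst nn_integral_distr) auto
  finally show ?thesis .
qed

text \<open>Fubini on the product law: the inner integral plays the part of the conditional
  expectation given \<open>a\<close>.\<close>

lemma (in prob_space) integral_independent_sample:
  fixes g :: "'b \<times> 'c \<Rightarrow> real"
  assumes ind: "independent_sample M A a Q \<zeta>" and g: "g \<in> borel_measurable (A \<Otimes>\<^sub>M Q)"
    and int: "integrable M (\<lambda>w. g (a w, \<zeta> w))"
  shows "(\<integral>w. g (a w, \<zeta> w) \<partial>M) = (\<integral>w. \<integral>z. g (a w, z) \<partial>Q \<partial>M)"
proof -
  have [measurable]: "random_variable A a" "random_variable Q \<zeta>"
    using independent_sampleD[OF ind] by auto
  interpret Q: prob_space Q using prob_space_distr[of \<zeta> Q] independent_sampleD[OF ind] by simp
  interpret D: prob_space "distr M A a" by (rule prob_space_distr) simp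
  interpret pair_sigma_finite "distr M A a" Q ..
  note g[measurable]
  have "integrable (distr M (A \<Otimes>\<^sub>M Q) (\<lambda>w. (a w, \<zeta> w))) g"
    using int by (subst integrable_distr_eq) auto
  then have int': "integrable (distr M A a \<Otimes>\<^sub>M Q) g"
    unfolding independent_sampleD(4)[OF ind] .
  have "(\<integral>w. g (a w, \<zeta> w) \<partial>M) = (\<integral>p. g p \<partial>distr M (A \<Otimes>\<^sub>M Q) (\<lambda>w. (a w, \<zeta> w)))"
    by (subst integral_distr) auto
  also have "\<dots> = (\<integral>v. \<integral>z. g (v, z) \<partial>Q \<partial>distr M A a)"
    unfolding independent_sampleD(4)[OF ind] using integral_fst'[OF int'] by simp
  also have "\<dots> = (\<integral>w. \<integral>z. g (a w, z) \<partial>Q \<partial>M)"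
    by (subst integral_distr) auto
  finally show ?thesis .
qed

text \<open>The sigma-algebra generated by the first \<open>l\<close> samples. As the pullback along
  one tuple-valued map, each of its events is the preimage of an event of the product space.\<close>

definition history :: "'w measure \<Rightarrow> (nat \<Rightarrow> 'w \<Rightarrow> 'z) \<Rightarrow> 'z measure \<Rightarrow> nat \<Rightarrow> 'w measure" where
  "history P \<xi> Q l = vimage_algebra (space P) (\<lambda>w. \<lambda>i\<in>{..<l}. \<xi> i w) (PiM {..<l} (\<lambda>_. Q))"

lemma space_history [simp]: "space (history P \<xi> Q l) = space P"
  by (simp add: history_def)

lemma sample_prefix_in_space:
  assumes "\<And>i. \<xi> i \<in> measurable P Q"
  shows "(\<lambda>w. \<lambda>i\<in>{..<l}. \<xi> i w) \<in> space P \<rightarrow> space (PiM {..<l} (\<lambda>_. Q))"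
proof -
  have "(\<lambda>w. \<lambda>i\<in>{..<l}. \<xi> i w) \<in> measurable P (PiM {..<l} (\<lambda>_. Q))"
    by (intro measurable_restrict assms)
  from measurable_space[OF this] show ?thesis by blast
qed

lemma measurable_history_sample:
  assumes "\<And>i. \<xi> i \<in> measurable P Q" "i < l"
  shows "\<xi> i \<in> measurable (history P \<xi> Q l) Q"
proof -
  have "(\<lambda>w. \<lambda>i\<in>{..<l}. \<xi> i w) \<in> measurable (history P \<xi> Q l) (PiM {..<l} (\<lambda>_. Q))"
    unfolding history_def
    using assms(1) by (intro measurable_vimage_algebra1 sample_prefix_in_space)
  from measurable_compose[OF this measurable_component_singleton[of i "{..<l}" "\<lambda>_. Q"]] assms(2)
  show ?thesis by simp
qed

lemma measurable_history_mono:
  assumes \<xi>: "\<And>i. \<xi> i \<in> measurable P Q" and "l \<le> m" and g: "g \<in> measurable (history P \<xi> Q l) B"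
  shows "g \<in> measurable (history P \<xi> Q m) B"
proof -
  have "(\<lambda>w. w) \<in> measurable (history P \<xi> Q m) (history P \<xi> Q l)"
    unfolding history_def[of _ _ _ l]
  proof (rule measurable_vimage_algebra2)
    show "(\<lambda>w. \<lambda>i\<in>{..<l}. \<xi> i w) \<in> measurable (history P \<xi> Q m) (PiM {..<l} (\<lambda>_. Q))"
      using assms(2) by (intro measurable_restrict measurable_history_sample[OF \<xi>]) auto
  qed simp
  then show ?thesis using g by (rule measurable_compose)
qed

lemma (in prob_space) measurable_history_imp_measurable:
  assumes \<xi>: "\<And>i. random_variable Q (\<xi> i)" and g: "g \<in> measurable (history M \<xi> Q l) B"
  shows "random_variable B g"
proof -
  have "(\<lambda>w. w) \<in> measurable M (history M \<xi> Q l)"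
    unfolding history_def using \<xi> by (intro measurable_vimage_algebra2 measurable_restrict) auto
  then show ?thesis using g by (rule measurable_compose)
qed

text \<open>Events of the history are preimages under the tuple of samples below \<open>l\<close>,
  which is independent of sample \<open>l\<close>. Probabilities therefore factor on rectangles, and
  these determine the joint law.\<close>

lemma (in prob_space) independent_sample_history:
  assumes ind: "indep_vars (\<lambda>_. Q) \<xi> UNIV" and distr: "distr M Q (\<xi> l) = Q"
    and g: "g \<in> measurable (history M \<xi> Q l) B"
  shows "independent_sample M B g Q (\<xi> l)"
proof -
  let ?A = "PiM {..<l} (\<lambda>_. Q)" and ?a = "\<lambda>w. \<lambda>i\<in>{..<l}. \<xi> i w"
  let ?A' = "PiM {l} (\<lambda>_. Q)" and ?a' = "\<lambda>w. \<lambda>i\<in>{l}. \<xi> i w"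
  have \<xi>[measurable]: "random_variable Q (\<xi> i)" for i using ind by (simp add: indep_vars_def)
  have rv[measurable]: "random_variable B g"
    using measurable_history_imp_measurable[OF \<xi> g] .
  \<comment> \<open>Sample \<open>l\<close> enters as a family over \<open>{l}\<close>, so that
    independence of disjoint blocks of indices applies; \<open>V\<close> below translates events of
    the sample into events of this family.\<close>
  have "indep_var ?A ?a ?A' ?a'"
    by (rule indep_var_restrict[OF ind]) auto
  then have split: "prob (?a -` S \<inter> space M \<inter> (?a' -` T \<inter> space M))
      = prob (?a -` S \<inter> space M) * prob (?a' -` T \<inter> space M)" if "S \<in> sets ?A" "T \<in> sets ?A'" for S T
    using that unfolding indep_var_eq indep_sets2_eq by blast
  have prod: "prob (g -` S \<inter> space M \<inter> (\<xi> l -` T \<inter> space M))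
      = prob (g -` S \<inter> space M) * prob (\<xi> l -` T \<inter> space M)" if S: "S \<in> sets B" and T: "T \<in> sets Q" for S T
  proof -
    have "sets (history M \<xi> Q l) = {?a -` U \<inter> space M | U. U \<in> sets ?A}"
      unfolding history_def
      using \<xi> by (intro sets_vimage_algebra2 sample_prefix_in_space)
    then obtain U where U: "U \<in> sets ?A" "g -` S \<inter> space M = ?a -` U \<inter> space M"
      using measurable_sets[OF g S] by auto
    define V where "V = (\<lambda>p. p l) -` T \<inter> space ?A'"
    have V: "V \<in> sets ?A'"
      unfolding V_def using T by (intro measurable_sets[OF measurable_component_singleton]) auto
    have "?a' -` V \<inter> space M = \<xi> l -` T \<inter> space M"
      using measurable_space[OF \<xi>[of l]] by (auto simp: V_def space_PiM)
    with split[OF U(1) V] U(2) show ?thesis by simp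
  qed
  interpret B: prob_space "distr M B g" by (rule prob_space_distr) simp
  interpret Q: prob_space Q using prob_space_distr[OF \<xi>[of l]] distr by simp
  interpret pair_sigma_finite "distr M B g" Q ..
  have "distr M B g \<Otimes>\<^sub>M Q = distr M (B \<Otimes>\<^sub>M Q) (\<lambda>w. (g w, \<xi> l w))"
  proof (rule pair_measure_eqI)
    fix S T assume "S \<in> sets (distr M B g)" and T: "T \<in> sets Q"
    then have S: "S \<in> sets B" by simp
    have "emeasure Q T = emeasure (distr M Q (\<xi> l)) T" by (simp add: distr)
    also have "\<dots> = emeasure M (\<xi> l -` T \<inter> space M)" using T by (simp add: emeasure_distr)
    finally have "emeasure (distr M B g) S * emeasure Q T
        = emeasure M (g -` S \<inter> space M) * emeasure M (\<xi> l -` T \<inter> space M)"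
      using S by (simp add: emeasure_distr)
    also have "\<dots> = emeasure M (g -` S \<inter> space M \<inter> (\<xi> l -` T \<inter> space M))"
      using prod[OF S T] by (simp add: emeasure_eq_measure ennreal_mult')
    also have "g -` S \<inter> space M \<inter> (\<xi> l -` T \<inter> space M) = (\<lambda>w. (g w, \<xi> l w)) -` (S \<times> T) \<inter> space M"
      by auto
    also have "emeasure M \<dots> = emeasure (distr M (B \<Otimes>\<^sub>M Q) (\<lambda>w. (g w, \<xi> l w))) (S \<times> T)"
      using S T by (subst emeasure_distr) auto
    finally show "emeasure (distr M B g) S * emeasure Q T
        = emeasure (distr M (B \<Otimes>\<^sub>M Q) (\<lambda>w. (g w, \<xi> l w))) (S \<times> T)" .
  qed (simp_all add: B.sigma_finite_measure_axioms Q.sigma_finite_measure_axioms)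
  then show ?thesis by (simp add: independent_sample_def distr)
qed

section \<open>Moments of the sampled oracle and of its linearizations\<close>

lemma (in prob_space) square_integrable_oracle:
  fixes s :: "'b \<Rightarrow> 'c \<Rightarrow> 'd::euclidean_space"
  assumes ind: "independent_sample M A a Q \<zeta>"
    and s: "(\<lambda>(x, z). s x z) \<in> borel_measurable (A \<Otimes>\<^sub>M Q)"
    and sq: "\<And>x. x \<in> space A \<Longrightarrow> integrable Q (\<lambda>z. (norm (s x z))\<^sup>2)"
    and le: "\<And>x. x \<in> space A \<Longrightarrow> (\<integral>z. (norm (s x z))\<^sup>2 \<partial>Q) \<le> B"
  shows "integrable M (\<lambda>w. (norm (s (a w) (\<zeta> w)))\<^sup>2)"
    and "(\<integral>w. (norm (s (a w) (\<zeta> w)))\<^sup>2 \<partial>M) \<le> B"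
proof -
  have a[measurable]: "random_variable A a" and [measurable]: "random_variable Q \<zeta>"
    using independent_sampleD[OF ind] by auto
  note s[measurable]
  have m: "(\<lambda>w. s (a w) (\<zeta> w)) \<in> borel_measurable M"
    using measurable_compose[OF _ s, of "\<lambda>w. (a w, \<zeta> w)"] by simp
  obtain w0 where "w0 \<in> space M" using not_empty by blast
  then have B: "0 \<le> B" using order_trans[OF _ le[of "a w0"]] measurable_space[OF a] by simp
  have "(\<integral>\<^sup>+w. ennreal ((norm (s (a w) (\<zeta> w)))\<^sup>2) \<partial>M)
      = (\<integral>\<^sup>+w. \<integral>\<^sup>+z. ennreal ((norm (s (a w) z))\<^sup>2) \<partial>Q \<partial>M)"
    using nn_integral_independent_sample[OF ind, of "\<lambda>p. ennreal ((norm (case_prod s p))\<^sup>2)"] by simp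
  \<comment> \<open>With the query point fixed, the integral over the fresh sample is at most
    \<open>B\<close>, uniformly in that point.\<close>
  also have "\<dots> \<le> (\<integral>\<^sup>+w. ennreal B \<partial>M)"
  proof (rule nn_integral_mono)
    fix w assume "w \<in> space M"
    then have "a w \<in> space A" using measurable_space[OF a] by simp
    then show "(\<integral>\<^sup>+z. ennreal ((norm (s (a w) z))\<^sup>2) \<partial>Q) \<le> ennreal B"
      using sq le by (subst nn_integral_eq_integral) (auto intro: ennreal_leI)
  qed
  finally have *: "(\<integral>\<^sup>+w. ennreal ((norm (s (a w) (\<zeta> w)))\<^sup>2) \<partial>M) \<le> ennreal B"
    by (simp add: emeasure_space_1)
  show int: "integrable M (\<lambda>w. (norm (s (a w) (\<zeta> w)))\<^sup>2)"
    using m * by (intro integrableI_bounded) (auto simp: le_less_trans)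
  show "(\<integral>w. (norm (s (a w) (\<zeta> w)))\<^sup>2 \<partial>M) \<le> B"
    using * B nn_integral_eq_integral[OF int] by simp
qed

text \<open>Jensen's inequality for the squared norm, obtained by pairing \<open>X\<close> with its
  own mean \<open>g\<close> and using \<open>2 a b \<le> a^2 + b^2\<close>; half of the squared norm
  of \<open>g\<close> is then absorbed on the left.\<close>

lemma (in prob_space) norm_integral_sq_le:
  fixes X :: "'a \<Rightarrow> 'b::euclidean_space"
  assumes "integrable M X" "integrable M (\<lambda>w. (norm (X w))\<^sup>2)"
  shows "(norm (\<integral>w. X w \<partial>M))\<^sup>2 \<le> (\<integral>w. (norm (X w))\<^sup>2 \<partial>M)"
proof -
  define g where "g = (\<integral>w. X w \<partial>M)"
  have "(norm g)\<^sup>2 = (\<integral>w. g \<bullet> X w \<partial>M)"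
    using assms(1) by (simp add: g_def power2_norm_eq_inner)
  also have "\<dots> \<le> (\<integral>w. ((norm g)\<^sup>2 + (norm (X w))\<^sup>2) / 2 \<partial>M)"
  proof (rule integral_mono)
    fix w
    have "g \<bullet> X w \<le> norm g * norm (X w)" by (rule norm_cauchy_schwarz)
    also have "\<dots> \<le> ((norm g)\<^sup>2 + (norm (X w))\<^sup>2) / 2"
      using sum_squares_bound[of "norm g" "norm (X w)"] by simp
    finally show "g \<bullet> X w \<le> ((norm g)\<^sup>2 + (norm (X w))\<^sup>2) / 2" .
  qed (use assms in auto)
  also have "\<dots> = ((norm g)\<^sup>2 + (\<integral>w. (norm (X w))\<^sup>2 \<partial>M)) / 2"
    using assms(2) by (simp add: prob_space)
  finally show ?thesis by (simp add: g_def)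
qed

text \<open>Averaging over the fresh sample replaces \<open>s\<close> by a subgradient at the query
  point, whose linearization lies below \<open>f xs\<close>. Boundedness of the domain supplies
  integrability.\<close>

lemma (in prob_space) expected_linearization_le:
  fixes s :: "'b::euclidean_space \<Rightarrow> 'c \<Rightarrow> 'b" and f :: "'b \<Rightarrow> real"
  assumes ind: "independent_sample M (restrict_space borel C) a Q \<zeta>"
    and s: "(\<lambda>(x, z). s x z) \<in> borel_measurable (restrict_space borel C \<Otimes>\<^sub>M Q)"
    and f: "f \<in> borel_measurable (restrict_space borel C)"
    and bdd: "\<And>x. x \<in> C \<Longrightarrow> \<bar>f x - f xs\<bar> \<le> k" "\<And>x. x \<in> C \<Longrightarrow> norm (xs - x) \<le> d"
    and sint: "\<And>x. x \<in> C \<Longrightarrow> integrable Q (s x)"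
    and sub: "\<And>x. x \<in> C \<Longrightarrow> f x + (\<integral>z. s x z \<partial>Q) \<bullet> (xs - x) \<le> f xs"
    and int: "integrable M (\<lambda>w. norm (s (a w) (\<zeta> w)))"
  shows "integrable M (\<lambda>w. f (a w) + s (a w) (\<zeta> w) \<bullet> (xs - a w) - f xs)"
    and "(\<integral>w. f (a w) + s (a w) (\<zeta> w) \<bullet> (xs - a w) - f xs \<partial>M) \<le> 0"
proof -
  have a[measurable]: "random_variable (restrict_space borel C) a" and [measurable]: "random_variable Q \<zeta>"
    using independent_sampleD[OF ind] by auto
  interpret Q: prob_space Q using prob_space_distr[of \<zeta> Q] independent_sampleD[OF ind] by simp
  have aC: "a w \<in> C" if "w \<in> space M" for w
    using measurable_space[OF a that] by (simp add: space_restrict_space)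
  have id[measurable]: "(\<lambda>x. x) \<in> measurable (restrict_space borel C) borel"
    by (intro measurable_restrict_space1) simp
  have fst[measurable]: "fst \<in> borel_measurable (restrict_space borel C \<Otimes>\<^sub>M Q)"
    by (rule measurable_compose[OF measurable_fst id])
  note s[measurable] f[measurable]
  define g where "g p = f (fst p) + case_prod s p \<bullet> (xs - fst p) - f xs" for p
  have g: "g \<in> borel_measurable (restrict_space borel C \<Otimes>\<^sub>M Q)"
    unfolding g_def using measurable_compose[OF measurable_fst f, of Q] by measurable
  have int': "integrable M (\<lambda>w. g (a w, \<zeta> w))"
  proof (rule Bochner_Integration.integrable_bound)
    show "(\<lambda>w. g (a w, \<zeta> w)) \<in> borel_measurable M"
      by (rule measurable_compose[OF _ g]) simp
    show "integrable M (\<lambda>w. k + norm (s (a w) (\<zeta> w)) * d)" using int by simp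
    show "AE w in M. norm (g (a w, \<zeta> w)) \<le> norm (k + norm (s (a w) (\<zeta> w)) * d)"
    proof (rule AE_I2)
      fix w assume "w \<in> space M"
      note C = bdd[OF aC[OF this]]
      have "\<bar>s (a w) (\<zeta> w) \<bullet> (xs - a w)\<bar> \<le> norm (s (a w) (\<zeta> w)) * norm (xs - a w)"
        by (rule Cauchy_Schwarz_ineq2)
      also have "\<dots> \<le> norm (s (a w) (\<zeta> w)) * d" using C by (intro mult_left_mono) auto
      finally show "norm (g (a w, \<zeta> w)) \<le> norm (k + norm (s (a w) (\<zeta> w)) * d)"
        using C(1) by (simp add: g_def)
    qed
  qed
  then show "integrable M (\<lambda>w. f (a w) + s (a w) (\<zeta> w) \<bullet> (xs - a w) - f xs)"
    by (simp add: g_def)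
  have "(\<integral>w. g (a w, \<zeta> w) \<partial>M) = (\<integral>w. \<integral>z. g (a w, z) \<partial>Q \<partial>M)"
    by (rule integral_independent_sample[OF ind g int'])
  also have "\<dots> \<le> 0"
  proof -
    have "(\<integral>z. g (a w, z) \<partial>Q) \<le> 0" if "w \<in> space M" for w
      using sint[OF aC[OF that]] sub[OF aC[OF that]] by (simp add: g_def Q.prob_space)
    \<comment> \<open>Passing to the negated integrand turns the sign of the inner integral into
      nonnegativity, which integrates directly.\<close>
    then have "0 \<le> (\<integral>w. - (\<integral>z. g (a w, z) \<partial>Q) \<partial>M)"
      by (intro Bochner_Integration.integral_nonneg) auto
    then show ?thesis by simp
  qed
  finally show "(\<integral>w. f (a w) + s (a w) (\<zeta> w) \<bullet> (xs - a w) - f xs \<partial>M) \<le> 0"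
    by (simp add: g_def)
qed

section \<open>Runs of the scheme\<close>

text \<open>Comparison with the finite objective value at \<open>x0\<close> puts the minimizer into
  the domain. All values are then real there, and the three-point inequality applies.\<close>

lemma prox_step:
  fixes h :: "real^'n \<Rightarrow> ereal"
  assumes h: "proper_closed_convex h" and lam: "0 < lam" and "x0 \<in> edom h"
    and arg: "is_arg_min (\<lambda>u. h u + ereal (S \<bullet> u) + ereal (1 / (2 * lam) * (norm (u - v))\<^sup>2)) (\<lambda>_. True) x"
  shows "x \<in> edom h"
    and "u \<in> edom h \<Longrightarrow>
        real_of_ereal (h x) + S \<bullet> x + 1 / (2 * lam) * (norm (x - v))\<^sup>2 + 1 / (2 * lam) * (norm (u - x))\<^sup>2
        \<le> real_of_ereal (h u) + S \<bullet> u + 1 / (2 * lam) * (norm (u - v))\<^sup>2"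
proof -
  have le: "h x + ereal (S \<bullet> x) + ereal (1 / (2 * lam) * (norm (x - v))\<^sup>2)
      \<le> h w + ereal (S \<bullet> w) + ereal (1 / (2 * lam) * (norm (w - v))\<^sup>2)" for w
    using arg by (auto simp: is_arg_min_def not_less)
  have "h x + ereal (S \<bullet> x) + ereal (1 / (2 * lam) * (norm (x - v))\<^sup>2) < \<infinity>"
    by (rule le_less_trans[OF le[of x0]]) (subst real_of_ereal_fin[OF h assms(3)], simp)
  then show x: "x \<in> edom h" by (cases "h x") (auto simp: edom_def)
  show "real_of_ereal (h x) + S \<bullet> x + 1 / (2 * lam) * (norm (x - v))\<^sup>2 + 1 / (2 * lam) * (norm (u - x))\<^sup>2
        \<le> real_of_ereal (h u) + S \<bullet> u + 1 / (2 * lam) * (norm (u - v))\<^sup>2" if u: "u \<in> edom h"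
  proof (rule prox_three_point[OF convex_on_real_of_ereal[OF h] _ x u])
    fix w assume w: "w \<in> edom h"
    show "real_of_ereal (h x) + S \<bullet> x + 1 / (2 * lam) * (norm (x - v))\<^sup>2
        \<le> real_of_ereal (h w) + S \<bullet> w + 1 / (2 * lam) * (norm (w - v))\<^sup>2"
      using le[of w] real_of_ereal_fin[OF h w] real_of_ereal_fin[OF h x]
      by (metis ereal_less_eq(3) plus_ereal.simps(1))
  qed (use lam in simp)
qed

lemma sum_telescope_pred:
  fixes g :: "nat \<Rightarrow> real"
  assumes "n \<le> K"
  shows "(\<Sum>k=Suc n..K. g (k - 1) - g k) = g n - g K"
  using assms by (induction K rule: dec_induct) auto

lemma exists_cycle:
  fixes c :: "nat \<Rightarrow> nat"
  assumes "c 0 = 0" "0 < j" "j \<le> c K"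
  obtains k where "k \<in> {1..K}" "c (k - 1) < j" "j \<le> c k"
proof -
  define k where "k = (LEAST k. j \<le> c k)"
  have k: "j \<le> c k" unfolding k_def using assms(3) by (rule LeastI)
  have "k \<le> K" unfolding k_def using assms(3) by (rule Least_le)
  moreover have "k \<noteq> 0" using k assms by (intro notI) simp
  moreover have "c (k - 1) < j"
    using not_less_Least[of "k - 1" "\<lambda>k. j \<le> c k"] \<open>k \<noteq> 0\<close> by (simp add: k_def)
  ultimately show thesis using k by (intro that) auto
qed

text \<open>This is the number of cycles that are averaged, so the output is a convex
  combination.\<close>

lemma real_ceiling_half: "real_of_int \<lceil>real K / 2\<rceil> = real (K - K div 2)"
proof (cases "even K")
  case True
  then obtain q where "K = 2 * q" by (rule evenE)
  then show ?thesis by simp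
next
  case False
  then obtain q where q: "K = 2 * q + 1" by (rule oddE)
  then have "\<lceil>real K / 2\<rceil> = int q + 1" by (intro ceiling_unique) (auto simp: field_simps)
  then show ?thesis using q by simp
qed

section \<open>Deterministic properties of a single run\<close>

context
  fixes h :: "real^'n \<Rightarrow> ereal" and s :: "real^'n \<Rightarrow> 'z \<Rightarrow> real^'n" and lam \<theta> :: real and K :: nat
    and x0 :: "real^'n" and z :: "nat \<Rightarrow> 'z" and c :: "nat \<Rightarrow> nat" and S x y :: "nat \<Rightarrow> real^'n"
  assumes run: "scpb_run h s lam \<theta> K x0 z c S x y"
begin

lemma scpb_run_start: "x 0 = x0" "c 0 = 0"
  using run by (auto simp: scpb_run_def)

lemmas scpb_run_cycle = bspec[OF run[unfolded scpb_run_def Let_def, THEN conjunct2, THEN conjunct2]]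

lemma scpb_run_cycle_nonempty: "k \<in> {1..K} \<Longrightarrow> c (k - 1) < c k"
  using conjunct1[OF scpb_run_cycle[of k]] by simp

lemma scpb_run_step:
  assumes k: "k \<in> {1..K}" and "c (k - 1) < j" "j \<le> c k"
  shows "S j = (if j = c (k - 1) + 1 then s (x (c (k - 1))) (z (c (k - 1)))
      else (1 - scpb_tau \<theta> K) *\<^sub>R s (x (j - 1)) (z (j - 1)) + scpb_tau \<theta> K *\<^sub>R S (j - 1))"
    and "is_arg_min (\<lambda>u. h u + ereal (S j \<bullet> u) + ereal (1 / (2 * lam) * (norm (u - x (c (k - 1))))\<^sup>2))
      (\<lambda>_. True) (x j)"
    and "y j = (if j = c (k - 1) + 1 then x j
      else (1 - scpb_tau \<theta> K) *\<^sub>R x j + scpb_tau \<theta> K *\<^sub>R y (j - 1))"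
proof -
  have "j \<in> {c (k - 1) + 1..c k}" using assms by simp
  note step = bspec[OF conjunct2[OF scpb_run_cycle[OF k]] this]
  show "S j = (if j = c (k - 1) + 1 then s (x (c (k - 1))) (z (c (k - 1)))
      else (1 - scpb_tau \<theta> K) *\<^sub>R s (x (j - 1)) (z (j - 1)) + scpb_tau \<theta> K *\<^sub>R S (j - 1))"
    using step by (rule conjunct1)
  show "is_arg_min (\<lambda>u. h u + ereal (S j \<bullet> u) + ereal (1 / (2 * lam) * (norm (u - x (c (k - 1))))\<^sup>2))
      (\<lambda>_. True) (x j)"
    using step[THEN conjunct2] by (rule conjunct1)
  show "y j = (if j = c (k - 1) + 1 then x j
      else (1 - scpb_tau \<theta> K) *\<^sub>R x j + scpb_tau \<theta> K *\<^sub>R y (j - 1))"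
    using step[THEN conjunct2] by (rule conjunct2)
qed

text \<open>Iteration \<open>c (k - 1) + Suc l\<close> aggregates subgradients taken at the
  prox-center and the \<open>l\<close> iterates after it, while \<open>y\<close> averages iterates
  shifted by one: the prox-center itself is not among them.\<close>

lemma scpb_run_geo_avg:
  assumes k: "k \<in> {1..K}" and "c (k - 1) + Suc l \<le> c k"
  shows "S (c (k - 1) + Suc l)
      = geo_avg (scpb_tau \<theta> K) (\<lambda>l. s (x (c (k - 1) + l)) (z (c (k - 1) + l))) l"
    and "y (c (k - 1) + Suc l) = geo_avg (scpb_tau \<theta> K) (\<lambda>l. x (c (k - 1) + Suc l)) l"
proof -
  define i where "i = c (k - 1)"
  note S = scpb_run_step(1)[OF k, folded i_def] and y = scpb_run_step(3)[OF k, folded i_def]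
  show "S (c (k - 1) + Suc l)
      = geo_avg (scpb_tau \<theta> K) (\<lambda>l. s (x (c (k - 1) + l)) (z (c (k - 1) + l))) l"
    using assms(2) unfolding i_def[symmetric]
  proof (induction l)
    case 0
    then show ?case using S[of "i + 1"] by simp
  next
    case (Suc l)
    then show ?case using S[of "i + Suc (Suc l)"] by simp
  qed
  show "y (c (k - 1) + Suc l) = geo_avg (scpb_tau \<theta> K) (\<lambda>l. x (c (k - 1) + Suc l)) l"
    using assms(2) unfolding i_def[symmetric]
  proof (induction l)
    case 0
    then show ?case using y[of "i + 1"] by simp
  next
    case (Suc l)
    then show ?case using y[of "i + Suc (Suc l)"] by simp
  qed
qed

lemma scpb_run_mem_domain:
  assumes "proper_closed_convex h" "0 < lam" "x0 \<in> edom h" "j \<le> c K"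
  shows "x j \<in> edom h"
proof (cases "j = 0")
  case False
  then obtain k where "k \<in> {1..K}" "c (k - 1) < j" "j \<le> c k"
    using exists_cycle[OF scpb_run_start(2) _ assms(4)] by auto
  then show ?thesis using scpb_run_step(2) prox_step(1)[OF assms(1-3)] by blast
qed (use assms scpb_run_start in simp)

lemma scpb_run_three_point:
  assumes "proper_closed_convex h" "0 < lam" "x0 \<in> edom h"
    and "k \<in> {1..K}" "c (k - 1) < j" "j \<le> c k" "u \<in> edom h"
  shows "real_of_ereal (h (x j)) + S j \<bullet> x j + 1 / (2 * lam) * (norm (x j - x (c (k - 1))))\<^sup>2
      + 1 / (2 * lam) * (norm (u - x j))\<^sup>2
      \<le> real_of_ereal (h u) + S j \<bullet> u + 1 / (2 * lam) * (norm (u - x (c (k - 1))))\<^sup>2"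
  using prox_step(2)[OF assms(1-3) scpb_run_step(2)[OF assms(4-6)] assms(7)] .

lemma scpb_run_mono: "k \<le> l \<Longrightarrow> l \<le> K \<Longrightarrow> c k \<le> c l"
proof (induction l rule: dec_induct)
  case (step l)
  then show ?case using scpb_run_cycle_nonempty[of "Suc l"] by simp
qed simp

end

section \<open>The scheme as a random process with deterministic cycle ends\<close>

locale scpb_process = prob_space P for P :: "'w measure" +
  fixes Q :: "'z measure" and \<xi> :: "nat \<Rightarrow> 'w \<Rightarrow> 'z" and f h :: "real^'n \<Rightarrow> ereal"
    and s :: "real^'n \<Rightarrow> 'z \<Rightarrow> real^'n" and lam \<theta> B d :: real and K :: nat
    and x0 xs :: "real^'n" and c :: "nat \<Rightarrow> nat" and S x y :: "nat \<Rightarrow> 'w \<Rightarrow> real^'n"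
  assumes indep: "indep_vars (\<lambda>_. Q) \<xi> UNIV" and distr: "\<And>j. distr P Q (\<xi> j) = Q"
    and f: "proper_closed_convex f" and h: "proper_closed_convex h" and dom: "edom h \<subseteq> edom f"
    and s: "(\<lambda>(x, z). s x z) \<in> borel_measurable (restrict_space borel (edom h) \<Otimes>\<^sub>M Q)"
    and s_integrable: "\<And>u. u \<in> edom h \<Longrightarrow> integrable Q (s u)"
    and subgradient: "\<And>u. u \<in> edom h \<Longrightarrow> (\<integral>z. s u z \<partial>Q) \<in> subdifferential f u"
    and s_square: "\<And>u. u \<in> edom h \<Longrightarrow> integrable Q (\<lambda>z. (norm (s u z))\<^sup>2)"
    and s_moment: "\<And>u. u \<in> edom h \<Longrightarrow> (\<integral>z. (norm (s u z))\<^sup>2 \<partial>Q) \<le> B\<^sup>2"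
    and B: "0 \<le> B"
    and diam: "\<And>u v. u \<in> edom h \<Longrightarrow> v \<in> edom h \<Longrightarrow> norm (u - v) \<le> d"
    and lam: "0 < lam" and \<theta>: "0 < \<theta>" and K: "1 \<le> K"
    and x0: "x0 \<in> edom h" and xs: "xs \<in> edom h"
    and run: "\<And>w. w \<in> space P \<Longrightarrow>
        scpb_run h s lam \<theta> K x0 (\<lambda>j. \<xi> j w) c (\<lambda>j. S j w) (\<lambda>j. x j w) (\<lambda>j. y j w)"
begin

abbreviation "fr u \<equiv> real_of_ereal (f u)"
abbreviation "hr u \<equiv> real_of_ereal (h u)"
abbreviation "\<tau> \<equiv> scpb_tau \<theta> K"

lemma \<tau>: "0 < \<tau>" "\<tau> \<le> 1" and \<tau>_ratio: "(1 - \<tau>) / \<tau> = 1 / (\<theta> * real K)"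
proof -
  have "0 < \<theta> * real K" using \<theta> K by simp
  then show "0 < \<tau>" "\<tau> \<le> 1" "(1 - \<tau>) / \<tau> = 1 / (\<theta> * real K)"
    by (auto simp: scpb_tau_def field_simps)
qed

lemma c_start: "c 0 = 0"
  and c_less: "k \<in> {1..K} \<Longrightarrow> c (k - 1) < c k"
  and c_mono: "k \<le> l \<Longrightarrow> l \<le> K \<Longrightarrow> c k \<le> c l"
proof -
  \<comment> \<open>The cycle ends are common to all paths, so their properties can be read off a
    single one.\<close>
  obtain w where "w \<in> space P" using not_empty by blast
  note r = run[OF this]
  show "c 0 = 0" using scpb_run_start(2)[OF r] .
  show "k \<in> {1..K} \<Longrightarrow> c (k - 1) < c k" using scpb_run_cycle_nonempty[OF r] .
  show "k \<le> l \<Longrightarrow> l \<le> K \<Longrightarrow> c k \<le> c l" using scpb_run_mono[OF r] .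
qed

lemma \<xi>_measurable: "\<xi> i \<in> measurable P Q"
  using indep by (simp add: indep_vars_def)

lemma prob_space_Q: "prob_space Q"
  using prob_space_distr[OF \<xi>_measurable] distr by metis

lemma x_mem: "w \<in> space P \<Longrightarrow> j \<le> c K \<Longrightarrow> x j w \<in> edom h"
  using scpb_run_mem_domain[OF run h lam x0] .

lemma convex_fr: "convex_on (edom h) fr"
  using convex_on_subset[OF convex_on_real_of_ereal[OF f] dom] convex_on_imp_convex
    convex_on_real_of_ereal[OF h] by blast

lemma convex_hr: "convex_on (edom h) hr"
  using convex_on_real_of_ereal[OF h] .

lemma fr_subgradient:
  assumes "u \<in> edom h" "v \<in> edom h"
  shows "fr u + (\<integral>z. s u z \<partial>Q) \<bullet> (v - u) \<le> fr v"
proof -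
  have "f u + ereal ((\<integral>z. s u z \<partial>Q) \<bullet> (v - u)) \<le> f v"
    using subgradient[OF assms(1)] by (simp add: subdifferential_def)
  then show ?thesis
    using real_of_ereal_fin[OF f, of u] real_of_ereal_fin[OF f, of v] assms dom
    by (metis ereal_less_eq(3) plus_ereal.simps(1) subsetD)
qed

text \<open>By Jensen the mean of \<open>s u\<close> is a subgradient of norm at most
  \<open>B\<close>; the subgradient inequality at \<open>u\<close> then bounds the increase from
  \<open>v\<close> to \<open>u\<close>.\<close>

lemma fr_lipschitz:
  assumes "u \<in> edom h" "v \<in> edom h"
  shows "fr u - fr v \<le> B * norm (u - v)"
proof -
  interpret Q: prob_space Q by (rule prob_space_Q)
  let ?g = "\<integral>z. s u z \<partial>Q"
  have "(norm ?g)\<^sup>2 \<le> B\<^sup>2"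
    using Q.norm_integral_sq_le[OF s_integrable[OF assms(1)] s_square[OF assms(1)]] s_moment[OF assms(1)]
    by simp
  then have g: "norm ?g \<le> B" using B by (simp add: power2_le_iff_abs_le)
  have "fr u - fr v \<le> ?g \<bullet> (u - v)"
    using fr_subgradient[OF assms] by (simp add: inner_diff_right)
  also have "\<dots> \<le> norm ?g * norm (u - v)" by (rule norm_cauchy_schwarz)
  also have "\<dots> \<le> B * norm (u - v)" using g by (intro mult_right_mono) auto
  finally show ?thesis .
qed

lemma S_geo_avg:
  assumes "w \<in> space P" "k \<in> {1..K}" "c (k - 1) + Suc l \<le> c k"
  shows "S (c (k - 1) + Suc l) w
      = geo_avg \<tau> (\<lambda>l. s (x (c (k - 1) + l) w) (\<xi> (c (k - 1) + l) w)) l"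
  using scpb_run_geo_avg(1)[OF run[OF assms(1)] assms(2,3)] .

text \<open>By strong induction, \<open>S j\<close> depends on samples and iterates of index below
  \<open>j\<close>, and the proximal step is nonexpansive in its input.\<close>

lemma x_adapted: "j \<le> c K \<Longrightarrow> x j \<in> borel_measurable (history P \<xi> Q j)"
proof (induction j rule: less_induct)
  case (less j)
  show ?case
  proof (cases "j = 0")
    case True
    have "x 0 w = x0" if "w \<in> space P" for w
      using scpb_run_start(1)[OF run[OF that]] .
    then have "x 0 \<in> borel_measurable (history P \<xi> Q 0) \<longleftrightarrow> (\<lambda>w. x0) \<in> borel_measurable (history P \<xi> Q 0)"
      by (intro measurable_cong) simp
    then show ?thesis using True by simp
  next
    case False
    then obtain k where k: "k \<in> {1..K}" "c (k - 1) < j" "j \<le> c k"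
      using exists_cycle[OF c_start _ less.prems] by auto
    define i where "i = c (k - 1)"
    define l where "l = j - Suc i"
    have j: "j = i + Suc l" using k by (simp add: i_def l_def)
    have x_prev: "x q \<in> borel_measurable (history P \<xi> Q j)" if "q < j" for q
      using less.IH[OF that] less.prems that
      by (intro measurable_history_mono[OF \<xi>_measurable, of q j]) auto
    have "(\<lambda>w. s (x q w) (\<xi> q w)) \<in> borel_measurable (history P \<xi> Q j)" if "q < j" for q
    proof -
      have "x q \<in> measurable (history P \<xi> Q j) (restrict_space borel (edom h))"
        using x_prev[OF that] x_mem that less.prems
        by (intro measurable_restrict_space2) auto
      then have "(\<lambda>w. (x q w, \<xi> q w)) \<in> measurable (history P \<xi> Q j) (restrict_space borel (edom h) \<Otimes>\<^sub>M Q)"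
        using measurable_history_sample[OF \<xi>_measurable that] by (rule measurable_Pair)
      from measurable_compose[OF this s] show ?thesis by simp
    qed
    then have "(\<lambda>w. geo_avg \<tau> (\<lambda>l. s (x (i + l) w) (\<xi> (i + l) w)) l) \<in> borel_measurable (history P \<xi> Q j)"
      using j by (intro borel_measurable_geo_avg) auto
    also have "?this \<longleftrightarrow> S j \<in> borel_measurable (history P \<xi> Q j)"
      using S_geo_avg[OF _ k(1), of _ l] k j unfolding i_def by (intro measurable_cong) auto
    finally have S: "S j \<in> borel_measurable (history P \<xi> Q j)" .
    \<comment> \<open>This is the argument of the proximal map that produces
      \<open>x j\<close>.\<close>
    have "(\<lambda>w. x i w - lam *\<^sub>R S j w) \<in> borel_measurable (history P \<xi> Q j)"
      using x_prev[of i] S j by auto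
    then show ?thesis
    proof (rule borel_measurable_of_nonexpansive)
      fix w w' assume w: "w \<in> space (history P \<xi> Q j)" "w' \<in> space (history P \<xi> Q j)"
      show "norm (x j w - x j w') \<le> norm ((x i w - lam *\<^sub>R S j w) - (x i w' - lam *\<^sub>R S j w'))"
        unfolding i_def using w x_mem less.prems scpb_run_three_point[OF run h lam x0 k]
        by (intro prox_nonexpansive[OF lam, where C = "edom h" and g = hr]) auto
    qed
  qed
qed

lemma x_measurable: "j \<le> c K \<Longrightarrow> x j \<in> borel_measurable P"
  using measurable_history_imp_measurable[OF \<xi>_measurable x_adapted] .

text \<open>Sample \<open>j\<close> is first consumed by iteration \<open>j + 1\<close>, so it is
  independent of the point \<open>x j\<close> at which the oracle is queried with it.\<close>

lemma fresh:
  assumes "j \<le> c K"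
  shows "independent_sample P (restrict_space borel (edom h)) (x j) Q (\<xi> j)"
  using x_adapted[OF assms] x_mem assms
  by (intro independent_sample_history[OF indep distr] measurable_restrict_space2) auto

lemma s_path_square:
  assumes "j \<le> c K"
  shows "integrable P (\<lambda>w. (norm (s (x j w) (\<xi> j w)))\<^sup>2)"
    and "(\<integral>w. (norm (s (x j w) (\<xi> j w)))\<^sup>2 \<partial>P) \<le> B\<^sup>2"
  by (rule square_integrable_oracle[OF fresh[OF assms] s, where B = "B\<^sup>2"];
      simp add: space_restrict_space s_square s_moment)+

lemma s_path_measurable:
  assumes "j \<le> c K"
  shows "(\<lambda>w. s (x j w) (\<xi> j w)) \<in> borel_measurable P"
proof -
  note [measurable] = independent_sampleD(1,2)[OF fresh[OF assms]]
  show ?thesis using measurable_compose[OF _ s, of "\<lambda>w. (x j w, \<xi> j w)"] by simp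
qed

lemma s_path_norm:
  assumes "j \<le> c K"
  shows "integrable P (\<lambda>w. norm (s (x j w) (\<xi> j w)))"
    and "(\<integral>w. norm (s (x j w) (\<xi> j w)) \<partial>P) \<le> B"
proof -
  note sq = s_path_square[OF assms]
  show int: "integrable P (\<lambda>w. norm (s (x j w) (\<xi> j w)))"
    by (rule square_integrable_imp_integrable[OF
        measurable_compose[OF s_path_measurable[OF assms] borel_measurable_norm] sq(1)])
  have "(norm (\<integral>w. norm (s (x j w) (\<xi> j w)) \<partial>P))\<^sup>2 \<le> B\<^sup>2"
    using norm_integral_sq_le[OF int, unfolded real_norm_def abs_norm_cancel, OF sq(1)] sq(2)
    unfolding real_norm_def by (rule order_trans)
  from power2_le_imp_le[OF this B] show "(\<integral>w. norm (s (x j w) (\<xi> j w)) \<partial>P) \<le> B" by simp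
qed

lemma noise_square:
  assumes "j \<le> c K"
  shows "integrable P (\<lambda>w. (B + norm (s (x j w) (\<xi> j w)))\<^sup>2)"
    and "(\<integral>w. (B + norm (s (x j w) (\<xi> j w)))\<^sup>2 \<partial>P) \<le> 4 * B\<^sup>2"
proof -
  let ?n = "\<lambda>w. norm (s (x j w) (\<xi> j w))"
  have eq: "(B + ?n w)\<^sup>2 = B\<^sup>2 + 2 * B * ?n w + (?n w)\<^sup>2" for w
    by (simp add: power2_sum algebra_simps)
  show "integrable P (\<lambda>w. (B + ?n w)\<^sup>2)"
    unfolding eq using s_path_square(1)[OF assms] s_path_norm(1)[OF assms] by simp
  have "(\<integral>w. (B + ?n w)\<^sup>2 \<partial>P) = B\<^sup>2 + 2 * B * (\<integral>w. ?n w \<partial>P) + (\<integral>w. (?n w)\<^sup>2 \<partial>P)"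
    unfolding eq using s_path_square(1)[OF assms] s_path_norm(1)[OF assms] by (simp add: prob_space)
  also have "\<dots> \<le> B\<^sup>2 + 2 * B * B + B\<^sup>2"
    using s_path_square(2)[OF assms] s_path_norm(2)[OF assms] B
    by (intro add_mono mult_left_mono) simp_all
  finally show "(\<integral>w. (B + ?n w)\<^sup>2 \<partial>P) \<le> 4 * B\<^sup>2" by (simp add: power2_eq_square)
qed

lemma linearization:
  assumes "j \<le> c K"
  shows "integrable P (\<lambda>w. fr (x j w) + s (x j w) (\<xi> j w) \<bullet> (xs - x j w) - fr xs)"
    and "(\<integral>w. fr (x j w) + s (x j w) (\<xi> j w) \<bullet> (xs - x j w) - fr xs \<partial>P) \<le> 0"
proof -
  have fr: "fr \<in> borel_measurable (restrict_space borel (edom h))"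
    using borel_measurable_closed_epigraph[of f] f
    by (intro measurable_restrict_space1 borel_measurable_real_of_ereal) (auto simp: proper_closed_convex_def)
  \<comment> \<open>Lipschitz continuity and the finite diameter give the uniform bound from which
    integrability of the linearization follows.\<close>
  have bdd: "\<bar>fr u - fr xs\<bar> \<le> B * d" if "u \<in> edom h" for u
  proof -
    have "B * norm (u - xs) \<le> B * d" using diam[OF that xs] B by (intro mult_left_mono)
    then show ?thesis
      using fr_lipschitz[OF that xs] fr_lipschitz[OF xs that] by (simp add: norm_minus_commute)
  qed
  have int: "integrable P (\<lambda>w. fr (x j w) + s (x j w) (\<xi> j w) \<bullet> (xs - x j w) - fr xs) \<and>
      (\<integral>w. fr (x j w) + s (x j w) (\<xi> j w) \<bullet> (xs - x j w) - fr xs \<partial>P) \<le> 0"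
    by (intro conjI expected_linearization_le[OF fresh[OF assms] s fr, where xs = xs, OF bdd diam[OF xs]])
      (auto intro: s_integrable fr_subgradient[OF _ xs] s_path_norm(1)[OF assms])
  then show "integrable P (\<lambda>w. fr (x j w) + s (x j w) (\<xi> j w) \<bullet> (xs - x j w) - fr xs)"
    and "(\<integral>w. fr (x j w) + s (x j w) (\<xi> j w) \<bullet> (xs - x j w) - fr xs \<partial>P) \<le> 0"
    by blast+
qed

text \<open>The part of the cycle estimate that does not telescope: linearization noise, the
  contracted initial gap, and the cost of noisy cuts. The cycle has \<open>m + 1\<close> iterations,
  hence the exponent \<open>m\<close>.\<close>

definition cycle_error :: "nat \<Rightarrow> 'w \<Rightarrow> real" where
  "cycle_error k w = (let i = c (k - 1); m = c k - Suc i; \<sigma> = (\<lambda>l. s (x (i + l) w) (\<xi> (i + l) w)) in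
     geo_avg \<tau> (\<lambda>l. fr (x (i + l) w) + \<sigma> l \<bullet> (xs - x (i + l) w) - fr xs) m
     + \<tau> ^ m * ((B + norm (\<sigma> 0)) * d)
     + geo_avg \<tau> (\<lambda>l. (1 - \<tau>) * lam * (B + norm (\<sigma> l))\<^sup>2 / (2 * \<tau>)) m)"

lemma y_geo_avg:
  assumes "w \<in> space P" and k: "k \<in> {1..K}"
  shows "y (c k) w = geo_avg \<tau> (\<lambda>l. x (c (k - 1) + Suc l) w) (c k - Suc (c (k - 1)))"
  using scpb_run_geo_avg(2)[OF run[OF assms(1)] k, of "c k - Suc (c (k - 1))"] c_less[OF k] by simp

lemma y_mem:
  assumes "w \<in> space P" and k: "k \<in> {1..K}"
  shows "y (c k) w \<in> edom h"
  unfolding y_geo_avg[OF assms] using \<tau> convex_on_imp_convex[OF convex_hr] c_less[OF k] c_mono[of k K] k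
  by (intro geo_avg_mem_convex x_mem[OF assms(1)]) auto

lemma cycle_pathwise:
  assumes w: "w \<in> space P" and k: "k \<in> {1..K}"
  shows "fr (y (c k) w) + hr (y (c k) w) - (fr xs + hr xs)
    \<le> ((norm (xs - x (c (k - 1)) w))\<^sup>2 - (norm (xs - x (c k) w))\<^sup>2) / (2 * lam) + cycle_error k w"
proof -
  define i where "i = c (k - 1)"
  define m where "m = c k - Suc i"
  have ck: "c k = i + Suc m" using c_less[OF k] by (simp add: i_def m_def)
  have cK: "c k \<le> c K" using c_mono[of k K] k by simp
  define \<sigma> where "\<sigma> l = s (x (i + l) w) (\<xi> (i + l) w)" for l
  have Seq: "S (i + Suc l) w = geo_avg \<tau> \<sigma> l" if "l \<le> m" for l
    using S_geo_avg[OF w k, of l] that ck unfolding i_def \<sigma>_def by simp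
  \<comment> \<open>The cycle estimate is applied to the shifted sequence
    \<open>x (i + l) w\<close>, whose zeroth term \<open>x (i + 0) w\<close> is the
    prox-center.\<close>
  have "fr (geo_avg \<tau> (\<lambda>l. x (i + Suc l) w) m) + hr (geo_avg \<tau> (\<lambda>l. x (i + Suc l) w) m) - (fr xs + hr xs)
    \<le> ((norm (xs - x (i + 0) w))\<^sup>2 - (norm (xs - x (i + Suc m) w))\<^sup>2) / (2 * lam)
      + geo_avg \<tau> (\<lambda>l. fr (x (i + l) w) + \<sigma> l \<bullet> (xs - x (i + l) w) - fr xs) m
      + \<tau> ^ m * ((B + norm (\<sigma> 0)) * d)
      + geo_avg \<tau> (\<lambda>l. (1 - \<tau>) * lam * (B + norm (\<sigma> l))\<^sup>2 / (2 * \<tau>)) m"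
  proof (rule cycle_estimate[OF convex_fr convex_hr \<tau> lam B fr_lipschitz diam _ xs])
    show "x (i + l) w \<in> edom h" if "l \<le> Suc m" for l
      using that cK ck by (intro x_mem[OF w]) simp
    show "hr (x (i + Suc l) w) + geo_avg \<tau> \<sigma> l \<bullet> x (i + Suc l) w
          + 1 / (2 * lam) * (norm (x (i + Suc l) w - x (i + 0) w))\<^sup>2
          + 1 / (2 * lam) * (norm (u - x (i + Suc l) w))\<^sup>2
        \<le> hr u + geo_avg \<tau> \<sigma> l \<bullet> u + 1 / (2 * lam) * (norm (u - x (i + 0) w))\<^sup>2"
      if "l \<le> m" "u \<in> edom h" for l u
      using scpb_run_three_point[OF run[OF w] h lam x0 k, of "i + Suc l" u] that ck Seq[OF that(1)]
      unfolding i_def by simp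
  qed
  then show ?thesis
    using y_geo_avg[OF w k] ck unfolding cycle_error_def Let_def i_def m_def \<sigma>_def by simp
qed

text \<open>The linearization noise has nonpositive mean; the mean oracle norm is at most
  \<open>B\<close>; and the cut cost is at most
  \<open>(1 - \<tau>) / \<tau> * (lam / 2) * (4 * B\<^sup>2)\<close> in mean, where the first ratio
  equals \<open>1 / (\<theta> * K)\<close>.\<close>

lemma cycle_error_expectation:
  assumes k: "k \<in> {1..K}"
  shows "integrable P (cycle_error k)"
    and "(\<integral>w. cycle_error k w \<partial>P)
      \<le> \<tau> ^ (c k - Suc (c (k - 1))) * (2 * B * d) + 2 * lam * B\<^sup>2 / (\<theta> * real K)"
proof -
  define i where "i = c (k - 1)"
  define m where "m = c k - Suc i"
  have le: "i + l \<le> c K" if "l \<le> m" for l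
    using c_less[OF k] c_mono[of k K] k that by (simp add: i_def m_def)
  let ?\<sigma> = "\<lambda>l w. s (x (i + l) w) (\<xi> (i + l) w)"
  let ?e = "\<lambda>l w. fr (x (i + l) w) + ?\<sigma> l w \<bullet> (xs - x (i + l) w) - fr xs"
  let ?b = "\<lambda>l w. (1 - \<tau>) * lam * (B + norm (?\<sigma> l w))\<^sup>2 / (2 * \<tau>)"
  have e: "integrable P (?e l)" "(\<integral>w. ?e l w \<partial>P) \<le> 0" if "l \<le> m" for l
    using linearization[OF le[OF that]] by auto
  have b: "integrable P (?b l)" if "l \<le> m" for l
    using noise_square[OF le[OF that]] by auto
  have b': "(\<integral>w. ?b l w \<partial>P) \<le> 2 * lam * B\<^sup>2 / (\<theta> * real K)" if "l \<le> m" for l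
  proof -
    have eq: "?b l w = ((1 - \<tau>) / \<tau>) * (lam / 2) * (B + norm (?\<sigma> l w))\<^sup>2" for w
      by simp
    have "(\<integral>w. ?b l w \<partial>P) = ((1 - \<tau>) / \<tau>) * (lam / 2) * (\<integral>w. (B + norm (?\<sigma> l w))\<^sup>2 \<partial>P)"
      unfolding eq by (rule integral_mult_right_zero)
    also have "\<dots> \<le> ((1 - \<tau>) / \<tau>) * (lam / 2) * (4 * B\<^sup>2)"
      using noise_square(2)[OF le[OF that]] \<tau> lam by (intro mult_left_mono) auto
    finally show ?thesis unfolding \<tau>_ratio by simp
  qed
  have n: "integrable P (\<lambda>w. norm (?\<sigma> 0 w))" "(\<integral>w. norm (?\<sigma> 0 w) \<partial>P) \<le> B"
    using s_path_norm[OF le[of 0]] by auto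
  have eq: "cycle_error k = (\<lambda>w. geo_avg \<tau> (\<lambda>l. ?e l w) m
      + \<tau> ^ m * ((B + norm (?\<sigma> 0 w)) * d) + geo_avg \<tau> (\<lambda>l. ?b l w) m)"
    unfolding cycle_error_def Let_def i_def m_def by simp
  have ge: "integrable P (\<lambda>w. geo_avg \<tau> (\<lambda>l. ?e l w) m)"
    and gb: "integrable P (\<lambda>w. geo_avg \<tau> (\<lambda>l. ?b l w) m)"
    using e(1) b by (auto intro!: integrable_geo_avg)
  have gn: "integrable P (\<lambda>w. \<tau> ^ m * ((B + norm (?\<sigma> 0 w)) * d))"
    using n(1) by simp
  show "integrable P (cycle_error k)"
    unfolding eq using ge gb gn by (intro Bochner_Integration.integrable_add)
  have d: "0 \<le> d" using diam[OF xs xs] by simp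
  have "(\<integral>w. cycle_error k w \<partial>P) = (\<integral>w. geo_avg \<tau> (\<lambda>l. ?e l w) m \<partial>P)
      + (\<integral>w. \<tau> ^ m * ((B + norm (?\<sigma> 0 w)) * d) \<partial>P) + (\<integral>w. geo_avg \<tau> (\<lambda>l. ?b l w) m \<partial>P)"
    unfolding eq using ge gb gn
    by (simp only: Bochner_Integration.integral_add Bochner_Integration.integrable_add)
  also have "\<dots> \<le> 0 + \<tau> ^ m * (2 * B * d) + 2 * lam * B\<^sup>2 / (\<theta> * real K)"
  proof (intro add_mono)
    have "(\<integral>w. geo_avg \<tau> (\<lambda>l. ?e l w) m \<partial>P) \<le> geo_avg \<tau> (\<lambda>_. 0) m"
      using e \<tau> by (subst integral_geo_avg) (auto intro!: geo_avg_mono)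
    then show "(\<integral>w. geo_avg \<tau> (\<lambda>l. ?e l w) m \<partial>P) \<le> 0" by (simp add: geo_avg_const)
    have "(\<integral>w. geo_avg \<tau> (\<lambda>l. ?b l w) m \<partial>P) \<le> geo_avg \<tau> (\<lambda>_. 2 * lam * B\<^sup>2 / (\<theta> * real K)) m"
      using b b' \<tau> by (subst integral_geo_avg) (auto intro!: geo_avg_mono)
    then show "(\<integral>w. geo_avg \<tau> (\<lambda>l. ?b l w) m \<partial>P) \<le> 2 * lam * B\<^sup>2 / (\<theta> * real K)"
      by (simp only: geo_avg_const)
    have "(\<integral>w. \<tau> ^ m * ((B + norm (?\<sigma> 0 w)) * d) \<partial>P) = \<tau> ^ m * ((B + (\<integral>w. norm (?\<sigma> 0 w) \<partial>P)) * d)"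
      using n(1) by (simp add: prob_space)
    also have "\<dots> \<le> \<tau> ^ m * ((B + B) * d)"
      using n(2) \<tau> d by (intro mult_left_mono mult_right_mono) auto
    finally show "(\<integral>w. \<tau> ^ m * ((B + norm (?\<sigma> 0 w)) * d) \<partial>P) \<le> \<tau> ^ m * (2 * B * d)"
      by (simp add: algebra_simps)
  qed
  finally show "(\<integral>w. cycle_error k w \<partial>P)
      \<le> \<tau> ^ (c k - Suc (c (k - 1))) * (2 * B * d) + 2 * lam * B\<^sup>2 / (\<theta> * real K)"
    by (simp add: m_def i_def)
qed

section \<open>The output, averaged over the second half of the cycles\<close>

definition y_out :: "'w \<Rightarrow> real^'n" where
  "y_out w = scpb_output K c (\<lambda>j. y j w)"

lemma y_out_eq: "y_out w = (\<Sum>k = K div 2 + 1..K. (1 / real (K - K div 2)) *\<^sub>R y (c k) w)"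
  unfolding y_out_def scpb_output_def real_ceiling_half by (simp add: scaleR_sum_right)

lemma y_out_mem:
  assumes "w \<in> space P"
  shows "y_out w \<in> edom h"
  unfolding y_out_eq using K y_mem[OF assms] convex_on_imp_convex[OF convex_hr]
  by (intro convex_sum) auto

lemma y_measurable:
  assumes k: "k \<in> {1..K}"
  shows "y (c k) \<in> borel_measurable P"
proof -
  have "(\<lambda>w. geo_avg \<tau> (\<lambda>l. x (c (k - 1) + Suc l) w) (c k - Suc (c (k - 1)))) \<in> borel_measurable P"
    using c_less[OF k] c_mono[of k K] k by (intro borel_measurable_geo_avg x_measurable) auto
  then show ?thesis using y_geo_avg[OF _ k] by (simp cong: measurable_cong)
qed

lemma y_out_measurable: "y_out \<in> borel_measurable P"
  unfolding y_out_eq[abs_def] using y_measurable by (intro borel_measurable_sum) auto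

lemma y_out_pathwise:
  assumes w: "w \<in> space P"
  shows "fr (y_out w) + hr (y_out w) - (fr xs + hr xs)
    \<le> (d\<^sup>2 / (2 * lam) + (\<Sum>k = K div 2 + 1..K. cycle_error k w)) / real (K - K div 2)"
proof -
  define N where "N = real (K - K div 2)"
  have N: "0 < N" using K by (simp add: N_def)
  have card: "real (card {K div 2 + 1..K}) = N" by (simp add: N_def)
  let ?p = "\<lambda>u. fr u + hr u"
  let ?g = "\<lambda>k. (norm (xs - x (c k) w))\<^sup>2 / (2 * lam)"
  have "?p (y_out w) \<le> (\<Sum>k = K div 2 + 1..K. (1 / N) * ?p (y (c k) w))"
    unfolding y_out_eq N_def using K y_mem[OF w]
    by (intro convex_on_sum[OF _ _ convex_on_add[OF convex_fr convex_hr]]) auto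
  also have "\<dots> \<le> (\<Sum>k = K div 2 + 1..K. (1 / N) * (?p xs + (?g (k - 1) - ?g k) + cycle_error k w))"
  proof (intro sum_mono mult_left_mono)
    fix k assume "k \<in> {K div 2 + 1..K}"
    then show "?p (y (c k) w) \<le> ?p xs + (?g (k - 1) - ?g k) + cycle_error k w"
      using cycle_pathwise[OF w, of k] by (simp add: diff_divide_distrib)
  qed (use N in simp)
  also have "\<dots> = (1 / N) * (N * ?p xs + (\<Sum>k = K div 2 + 1..K. ?g (k - 1) - ?g k)
      + (\<Sum>k = K div 2 + 1..K. cycle_error k w))"
    unfolding sum_distrib_left[symmetric] sum.distrib sum_constant card
    by (simp only: distrib_left)
  also have "(\<Sum>k = K div 2 + 1..K. ?g (k - 1) - ?g k) = ?g (K div 2) - ?g K"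
    using sum_telescope_pred[of "K div 2" K ?g] by simp
  \<comment> \<open>After telescoping, the diameter bounds the first squared distance and the last
    one is discarded.\<close>
  also have "(1 / N) * (N * ?p xs + (?g (K div 2) - ?g K) + (\<Sum>k = K div 2 + 1..K. cycle_error k w))
      \<le> (1 / N) * (N * ?p xs + d\<^sup>2 / (2 * lam) + (\<Sum>k = K div 2 + 1..K. cycle_error k w))"
  proof -
    have "norm (xs - x (c (K div 2)) w) \<le> d"
      using c_mono[of "K div 2" K] by (intro diam[OF xs] x_mem[OF w]) auto
    then have "?g (K div 2) \<le> d\<^sup>2 / (2 * lam)"
      using lam by (intro divide_right_mono power_mono) auto
    moreover have "0 \<le> ?g K" using lam by simp
    ultimately show ?thesis using N by (intro mult_left_mono) auto
  qed
  also have "\<dots> = ?p xs + (d\<^sup>2 / (2 * lam) + (\<Sum>k = K div 2 + 1..K. cycle_error k w)) / N"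
    using N by (simp add: field_simps)
  finally show ?thesis by (simp add: N_def)
qed

text \<open>Only cycles with \<open>2 * k > K\<close> enter the output, which is why a uniform
  \<open>\<epsilon>\<close> suffices. Minimality of \<open>xs\<close> supplies the lower bound for
  integrability of the objective.\<close>

theorem y_out_expected_gap:
  assumes min: "\<And>u. u \<in> edom h \<Longrightarrow> fr xs + hr xs \<le> fr u + hr u"
    and tail: "\<And>k. k \<in> {1..K} \<Longrightarrow> K < 2 * k \<Longrightarrow> \<tau> ^ (c k - Suc (c (k - 1))) \<le> \<epsilon>"
  shows "integrable P (\<lambda>w. fr (y_out w) + hr (y_out w))"
    and "(\<integral>w. fr (y_out w) + hr (y_out w) \<partial>P) - (fr xs + hr xs)
      \<le> d\<^sup>2 / (lam * real K) + 2 * \<epsilon> * B * d + 2 * lam * B\<^sup>2 / (\<theta> * real K)"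
proof -
  define N where "N = real (K - K div 2)"
  have N: "0 < N" "real K \<le> 2 * N" using K by (auto simp: N_def)
  \<comment> \<open>An integrable pathwise majorant: the objective at the output lies between the
    optimal value and \<open>U\<close>.\<close>
  define U where "U w = fr xs + hr xs + (d\<^sup>2 / (2 * lam) + (\<Sum>k = K div 2 + 1..K. cycle_error k w)) / N" for w
  have err: "integrable P (\<lambda>w. \<Sum>k = K div 2 + 1..K. cycle_error k w)"
    using cycle_error_expectation(1) by (intro Bochner_Integration.integrable_sum) auto
  then have U: "integrable P U" unfolding U_def by simp
  have bounds: "fr xs + hr xs \<le> fr (y_out w) + hr (y_out w)" "fr (y_out w) + hr (y_out w) \<le> U w"
    if "w \<in> space P" for w
    using min[OF y_out_mem[OF that]] y_out_pathwise[OF that] by (simp_all add: U_def N_def)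
  have [measurable]: "f \<in> borel_measurable borel" "h \<in> borel_measurable borel"
    using f h borel_measurable_closed_epigraph by (auto simp: proper_closed_convex_def)
  note y_out_measurable[measurable]
  show int: "integrable P (\<lambda>w. fr (y_out w) + hr (y_out w))"
  proof (rule Bochner_Integration.integrable_bound)
    show "integrable P (\<lambda>w. \<bar>fr xs + hr xs\<bar> + \<bar>U w\<bar>)" using U by simp
    show "AE w in P. norm (fr (y_out w) + hr (y_out w)) \<le> norm (\<bar>fr xs + hr xs\<bar> + \<bar>U w\<bar>)"
      using bounds by (intro AE_I2) fastforce
  qed measurable
  have "(\<integral>w. fr (y_out w) + hr (y_out w) \<partial>P) \<le> (\<integral>w. U w \<partial>P)"
    using int U bounds by (intro integral_mono) auto
  also have "\<dots> = fr xs + hr xs + (d\<^sup>2 / (2 * lam) + (\<Sum>k = K div 2 + 1..K. \<integral>w. cycle_error k w \<partial>P)) / N"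
    unfolding U_def using err cycle_error_expectation(1) by (simp add: prob_space)
  also have "\<dots> \<le> fr xs + hr xs + (d\<^sup>2 / (2 * lam) + N * (2 * \<epsilon> * B * d + 2 * lam * B\<^sup>2 / (\<theta> * real K))) / N"
  proof (intro add_left_mono divide_right_mono)
    have "(\<Sum>k = K div 2 + 1..K. \<integral>w. cycle_error k w \<partial>P)
        \<le> (\<Sum>k = K div 2 + 1..K. 2 * \<epsilon> * B * d + 2 * lam * B\<^sup>2 / (\<theta> * real K))"
    proof (rule sum_mono)
      fix k assume "k \<in> {K div 2 + 1..K}"
      then have k: "k \<in> {1..K}" "K < 2 * k" by auto
      have "\<tau> ^ (c k - Suc (c (k - 1))) * (2 * B * d) \<le> \<epsilon> * (2 * B * d)"
        using tail[OF k] B diam[OF xs xs] by (intro mult_right_mono) auto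
      then show "(\<integral>w. cycle_error k w \<partial>P) \<le> 2 * \<epsilon> * B * d + 2 * lam * B\<^sup>2 / (\<theta> * real K)"
        using cycle_error_expectation(2)[OF k(1)] by (simp add: algebra_simps)
    qed
    then show "(\<Sum>k = K div 2 + 1..K. \<integral>w. cycle_error k w \<partial>P)
        \<le> N * (2 * \<epsilon> * B * d + 2 * lam * B\<^sup>2 / (\<theta> * real K))"
      by (simp add: N_def)
  qed (use N in simp)
  also have "\<dots> = fr xs + hr xs + d\<^sup>2 / (lam * (2 * N)) + (2 * \<epsilon> * B * d + 2 * lam * B\<^sup>2 / (\<theta> * real K))"
    using N by (simp add: add_divide_distrib)
  \<comment> \<open>At least half of the cycles are averaged, that is
    \<open>K \<le> 2 * N\<close>.\<close>
  also have "d\<^sup>2 / (lam * (2 * N)) \<le> d\<^sup>2 / (lam * real K)"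
    using N lam K by (intro divide_left_mono mult_left_mono mult_pos_pos) auto
  finally show "(\<integral>w. fr (y_out w) + hr (y_out w) \<partial>P) - (fr xs + hr xs)
      \<le> d\<^sup>2 / (lam * real K) + 2 * \<epsilon> * B * d + 2 * lam * B\<^sup>2 / (\<theta> * real K)"
    by simp
qed

end

section \<open>Cycle lengths\<close>

text \<open>The rule computes each cycle end from the previous one and fixed parameters, so no
  sample can influence it.\<close>

lemma scpb1_cycle_rule_unique:
  assumes "scpb1_cycle_rule lam \<theta> K R c" "scpb1_cycle_rule lam \<theta> K R c'" "c 0 = c' 0" "k \<le> K"
  shows "c k = c' k"
  using assms(4)
proof (induction k)
  case (Suc k)
  then have "Suc k \<in> {1..K}" "c k = c' k" by auto
  then show ?case
    using bspec[OF assms(1)[unfolded scpb1_cycle_rule_def Let_def], of "Suc k"]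
      bspec[OF assms(2)[unfolded scpb1_cycle_rule_def Let_def], of "Suc k"] by simp
qed (use assms(3) in simp)

text \<open>A run consults its cycle ends only up to index \<open>K\<close>, so path-dependent ends
  may be exchanged for one common sequence.\<close>

lemma scpb_run_cycle_cong:
  assumes eq: "\<And>k. k \<le> K \<Longrightarrow> c k = c' k" and run: "scpb_run h s lam \<theta> K x0 z c S x y"
  shows "scpb_run h s lam \<theta> K x0 z c' S x y"
proof -
  have "c (k - 1) = c' (k - 1)" "c k = c' k" if "k \<in> {1..K}" for k
    using that by (auto intro!: eq)
  moreover have "c 0 = c' 0" by (simp add: eq)
  ultimately have "scpb_run h s lam \<theta> K x0 z c S x y \<longleftrightarrow> scpb_run h s lam \<theta> K x0 z c' S x y"
    unfolding scpb_run_def Let_def by (simp only: cong: ball_cong)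
  then show ?thesis using run by blast
qed

lemma ln0p_mono: "0 < a \<Longrightarrow> a \<le> b \<Longrightarrow> ln0p a \<le> ln0p b"
  unfolding ln0p_def by (intro max.mono) auto

text \<open>Since \<open>\<tau> < 1\<close>, the stopping test is eventually met. It fails one index
  before the end of a longer cycle; taking logarithms there and using
  \<open>ln \<tau> \<le> \<tau> - 1\<close> bounds the length.\<close>

lemma scpb1_cycle_length:
  assumes rule: "scpb1_cycle_rule lam \<theta> K R c" and pos: "0 < lam" "0 < \<theta>" "0 < R" and k: "k \<in> {1..K}"
  shows "c (k - 1) < c k"
    and "lam * real k * scpb_tau \<theta> K ^ (c k - Suc (c (k - 1))) \<le> R"
    and "real (c k) \<le> real (c (k - 1)) + 2 + (\<theta> * real K + 1) * ln0p (lam * real k / R)"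
proof -
  define i where "i = c (k - 1) + 1"
  define \<tau> where "\<tau> = scpb_tau \<theta> K"
  define Acc where "Acc j \<longleftrightarrow> i \<le> j \<and> lam * real k * \<tau> ^ (j - i) \<le> R" for j
  have ck: "c k = (LEAST j. Acc j)"
    using bspec[OF rule[unfolded scpb1_cycle_rule_def Let_def] k] by (simp add: Acc_def i_def \<tau>_def)
  have T: "0 < \<theta> * real K" using pos k by simp
  then have \<tau>: "0 < \<tau>" "\<tau> < 1" "1 - \<tau> = 1 / (\<theta> * real K + 1)"
    by (auto simp: \<tau>_def scpb_tau_def field_simps)
  have lk: "0 < lam * real k" using pos k by simp
  obtain n where "\<tau> ^ n < R / (lam * real k)"
    using real_arch_pow_inv[of "R / (lam * real k)" \<tau>] \<tau> pos lk by auto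
  then have "Acc (i + n)" using lk by (simp add: Acc_def field_simps)
  then have acc: "Acc (c k)" unfolding ck by (rule LeastI)
  then show "c (k - 1) < c k" by (simp add: Acc_def i_def)
  show "lam * real k * scpb_tau \<theta> K ^ (c k - Suc (c (k - 1))) \<le> R"
    using acc by (simp add: Acc_def i_def \<tau>_def)
  have L: "0 \<le> ln0p (lam * real k / R)" by (simp add: ln0p_def)
  show "real (c k) \<le> real (c (k - 1)) + 2 + (\<theta> * real K + 1) * ln0p (lam * real k / R)"
  proof (cases "c k = i")
    case True
    have "0 \<le> (\<theta> * real K + 1) * ln0p (lam * real k / R)" using T L by simp
    then show ?thesis using True by (simp add: i_def)
  next
    case False
    \<comment> \<open>\<open>m\<close> is the exponent in the last failed test. The cycle has
      \<open>m + 2\<close> iterations, which explains the summand 2.\<close>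
    define m where "m = c k - 1 - i"
    have m: "c k = i + Suc m" using False acc by (simp add: m_def Acc_def)
    have "\<not> Acc (i + m)" using not_less_Least[of "i + m" Acc] ck m by simp
    then have "R / (lam * real k) < \<tau> ^ m" using lk by (simp add: Acc_def field_simps)
    then have "ln (R / (lam * real k)) < ln (\<tau> ^ m)" using pos lk \<tau> by (intro ln_less_cancel_iff[THEN iffD2]) auto
    then have "- ln (lam * real k / R) < real m * ln \<tau>"
      using pos lk \<tau> k by (simp add: ln_div ln_realpow)
    moreover have "real m * ln \<tau> \<le> real m * (\<tau> - 1)"
      using ln_le_minus_one[of \<tau>] \<tau> by (intro mult_left_mono) auto
    moreover have "ln (lam * real k / R) \<le> ln0p (lam * real k / R)" by (simp add: ln0p_def)
    ultimately have "real m * (1 - \<tau>) \<le> ln0p (lam * real k / R)" by (simp add: algebra_simps)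
    then have "real m \<le> (\<theta> * real K + 1) * ln0p (lam * real k / R)"
      using T unfolding \<tau>(3) by (simp add: field_simps)
    then show ?thesis by (simp add: m i_def)
  qed
qed

lemma scpb1_total_length:
  assumes rule: "scpb1_cycle_rule lam \<theta> K R c" and c0: "c 0 = 0" and pos: "0 < lam" "0 < \<theta>" "0 < R"
  shows "real (c K) \<le> real K * (2 + (\<theta> * real K + 1) * ln0p (lam * real K / R))"
proof -
  let ?b = "2 + (\<theta> * real K + 1) * ln0p (lam * real K / R)"
  have "real (c k) \<le> real k * ?b" if "k \<le> K" for k
    using that
  proof (induction k)
    case (Suc k)
    have "ln0p (lam * real (Suc k) / R) \<le> ln0p (lam * real K / R)"
      using pos Suc.prems by (intro ln0p_mono divide_right_mono mult_left_mono) auto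
    then have "(\<theta> * real K + 1) * ln0p (lam * real (Suc k) / R) \<le> (\<theta> * real K + 1) * ln0p (lam * real K / R)"
      using pos by (intro mult_left_mono) auto
    moreover have "real (c (Suc k)) \<le> real (c k) + 2 + (\<theta> * real K + 1) * ln0p (lam * real (Suc k) / R)"
      using scpb1_cycle_length(3)[OF rule pos, of "Suc k"] Suc.prems by simp
    ultimately have "real (c (Suc k)) \<le> real k * ?b + ?b"
      using Suc.IH Suc.prems by linarith
    then show ?case by (simp add: distrib_right)
  qed (simp add: c0)
  then show ?thesis by blast
qed

section \<open>Constants and assembly of the two bounds\<close>

lemma second_moment_le_moment_bound:
  assumes "second_moment_bounded Q X s" "u \<in> X"
  shows "(\<integral>z. (norm (s u z))\<^sup>2 \<partial>Q) \<le> (moment_bound Q X s)\<^sup>2" "0 \<le> moment_bound Q X s"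
proof -
  have nn: "0 \<le> (\<integral>z. (norm (s u z))\<^sup>2 \<partial>Q)" by simp
  have le: "sqrt (\<integral>z. (norm (s u z))\<^sup>2 \<partial>Q) \<le> moment_bound Q X s"
    unfolding moment_bound_def using assms
    by (intro cSUP_upper) (auto simp: second_moment_bounded_def)
  then show "(\<integral>z. (norm (s u z))\<^sup>2 \<partial>Q) \<le> (moment_bound Q X s)\<^sup>2"
    by (rule sqrt_le_D)
  show "0 \<le> moment_bound Q X s" using le nn by (meson order_trans real_sqrt_ge_zero)
qed

text \<open>With \<open>q = D * Ms / M\<close> the left side becomes
  \<open>(d^2 + 2/3 q d + q^2) / (lam * k)\<close>. Since \<open>2 q d \<le> q^2 + d^2\<close>, the
  factor 4/3 would do, and 3/2 leaves room.\<close>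

lemma optimality_gap_constant:
  fixes lam M D Ms d :: real
  assumes "0 < lam" "0 < M" "0 < D" "0 < k"
  shows "d\<^sup>2 / (lam * k) + 2 * (D / (3 * M * lam * k)) * Ms * d
      + 2 * lam * Ms\<^sup>2 / (2 * lam\<^sup>2 * M\<^sup>2 / D\<^sup>2 * k)
    \<le> 3 * D\<^sup>2 / (2 * lam * k) * (d\<^sup>2 / D\<^sup>2 + Ms\<^sup>2 / M\<^sup>2)"
proof -
  define q where "q = D * Ms / M"
  have *: "2 * (q * d) \<le> q\<^sup>2 + d\<^sup>2" using sum_squares_bound[of q d] by simp
  have "e + 2 / 3 * p + b \<le> 3 / 2 * (e + b)" if "2 * p \<le> b + e" "0 \<le> b" "0 \<le> e" for e p b :: real
    using that by (simp add: field_simps)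
  from this[OF *] have "d\<^sup>2 + 2 / 3 * (q * d) + q\<^sup>2 \<le> 3 / 2 * (d\<^sup>2 + q\<^sup>2)"
    by (simp only: zero_le_power2)
  then have "(d\<^sup>2 + 2 / 3 * (q * d) + q\<^sup>2) / (lam * k) \<le> 3 / 2 * (d\<^sup>2 + q\<^sup>2) / (lam * k)"
    using assms by (intro divide_right_mono) auto
  moreover have "d\<^sup>2 / (lam * k) + 2 * (D / (3 * M * lam * k)) * Ms * d
      + 2 * lam * Ms\<^sup>2 / (2 * lam\<^sup>2 * M\<^sup>2 / D\<^sup>2 * k) = (d\<^sup>2 + 2 / 3 * (q * d) + q\<^sup>2) / (lam * k)"
    using assms by (simp add: q_def field_simps power2_eq_square)
  moreover have "3 * D\<^sup>2 / (2 * lam * k) * (d\<^sup>2 / D\<^sup>2 + Ms\<^sup>2 / M\<^sup>2) = 3 / 2 * (d\<^sup>2 + q\<^sup>2) / (lam * k)"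
    using assms by (simp add: q_def field_simps power2_eq_square)
  ultimately show ?thesis by simp
qed

theorem corollary3p2:
  fixes P :: "'w measure"
    and Q :: "(real^'m) measure"
    and \<xi> :: "nat \<Rightarrow> 'w \<Rightarrow> real^'m"
    and f h \<phi> :: "real^'n \<Rightarrow> ereal"
    and F :: "real^'n \<Rightarrow> real^'m \<Rightarrow> real"
    and s :: "real^'n \<Rightarrow> real^'m \<Rightarrow> real^'n"
    and lam \<theta> R D M D\<^sub>h M\<^sub>s \<kappa>\<^sub>D \<kappa>\<^sub>M :: real
    and K :: nat
    and x0 :: "real^'n"
    and c :: "nat \<Rightarrow> 'w \<Rightarrow> nat"
    and S x y :: "nat \<Rightarrow> 'w \<Rightarrow> real^'n"
    and yout :: "'w \<Rightarrow> real^'n"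
  assumes P: "prob_space P"
    and Q: "prob_space Q" "sets Q = sets borel"
    and samples: "iid_samples P \<xi> Q"
    and phi: "\<phi> = (\<lambda>u. f u + h u)"
    and A1: "proper_closed_convex f" "proper_closed_convex h" "edom h \<subseteq> edom f"
    and A2: "stochastic_oracles Q f (edom h) F s"
    and A3: "second_moment_bounded Q (edom h) s" "M\<^sub>s = moment_bound Q (edom h) s"
    and A4: "optimal_set \<phi> \<noteq> {}"
    and diam: "bounded (edom h)" "D\<^sub>h = diameter (edom h)" "D\<^sub>h > 0"
    and input: "lam > 0" "K \<ge> 1" "x0 \<in> edom h" "D > 0" "M > 0"
    and theta: "\<theta> = 2 * lam\<^sup>2 * M\<^sup>2 / D\<^sup>2"
    and R: "R = D / (6 * M)"
    and kappa: "\<kappa>\<^sub>D = D\<^sub>h\<^sup>2 / D\<^sup>2" "\<kappa>\<^sub>M = M\<^sub>s\<^sup>2 / M\<^sup>2"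
    and run: "\<And>\<omega>. \<omega> \<in> space P \<Longrightarrow>
        scpb_run h s lam \<theta> K x0 (\<lambda>j. \<xi> j \<omega>) (\<lambda>k. c k \<omega>)
          (\<lambda>j. S j \<omega>) (\<lambda>j. x j \<omega>) (\<lambda>j. y j \<omega>)"
    and rule: "\<And>\<omega>. \<omega> \<in> space P \<Longrightarrow> scpb1_cycle_rule lam \<theta> K R (\<lambda>k. c k \<omega>)"
    and yout: "yout = (\<lambda>\<omega>. scpb_output K (\<lambda>k. c k \<omega>) (\<lambda>j. y j \<omega>))"
  shows "((AE \<omega> in P. \<phi> (yout \<omega>) < \<infinity>) \<and>
          integrable P (\<lambda>\<omega>. real_of_ereal (\<phi> (yout \<omega>))) \<and>
          (\<integral>\<omega>. real_of_ereal (\<phi> (yout \<omega>)) \<partial>P) - real_of_ereal (optimal_value \<phi>)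
            \<le> 3 * D\<^sup>2 / (2 * lam * real K) * (\<kappa>\<^sub>D + \<kappa>\<^sub>M))
       \<and> (integrable P (\<lambda>\<omega>. real (c K \<omega>)) \<and>
          (\<integral>\<omega>. real (c K \<omega>) \<partial>P)
            \<le> 2 * ((lam\<^sup>2 * M\<^sup>2 * (real K)\<^sup>2 / D\<^sup>2 + real K) * (1 + ln0p (lam * real K / R))))"
proof -
  interpret P: prob_space P by (rule P)
  obtain \<omega>\<^sub>0 where \<omega>\<^sub>0: "\<omega>\<^sub>0 \<in> space P" using P.not_empty by blast
  \<comment> \<open>One path fixes the cycle ends; by uniqueness they are those of every path up to
    \<open>K\<close>.\<close>
  define cc where "cc k = c k \<omega>\<^sub>0" for k
  have c0: "c 0 \<omega> = 0" if "\<omega> \<in> space P" for \<omega> using scpb_run_start(2)[OF run[OF that]] .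
  have rule': "scpb1_cycle_rule lam \<theta> K R cc" unfolding cc_def by (rule rule[OF \<omega>\<^sub>0])
  have cc: "c k \<omega> = cc k" if "\<omega> \<in> space P" "k \<le> K" for k \<omega>
    using scpb1_cycle_rule_unique[OF rule[OF that(1)] rule' _ that(2)] c0[OF that(1)] c0[OF \<omega>\<^sub>0]
    by (simp add: cc_def)
  have cc0: "cc 0 = 0" using c0[OF \<omega>\<^sub>0] by (simp add: cc_def)
  have run': "scpb_run h s lam \<theta> K x0 (\<lambda>j. \<xi> j \<omega>) cc (\<lambda>j. S j \<omega>) (\<lambda>j. x j \<omega>) (\<lambda>j. y j \<omega>)"
    if "\<omega> \<in> space P" for \<omega>
    using scpb_run_cycle_cong[OF cc[OF that] run[OF that]] .
  have \<theta>: "0 < \<theta>" and Rpos: "0 < R" using theta R input by auto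
  have fin: "\<phi> u = ereal (real_of_ereal (f u) + real_of_ereal (h u))" if "u \<in> edom h" for u
    using real_of_ereal_fin[OF A1(1), of u] real_of_ereal_fin[OF A1(2), of u] that A1(3)
    unfolding phi by (metis plus_ereal.simps(1) subsetD)
  obtain xs where "is_arg_min \<phi> (\<lambda>_. True) xs" using A4 by (auto simp: optimal_set_def)
  then have xs_min: "\<phi> xs \<le> \<phi> u" for u by (auto simp: is_arg_min_def not_less)
  have "\<phi> xs < \<infinity>"
    by (rule le_less_trans[OF xs_min[of x0]]) (simp add: fin[OF input(3)])
  moreover have "f xs \<noteq> -\<infinity>" using A1(1) by (simp add: proper_closed_convex_def)
  ultimately have xs: "xs \<in> edom h" by (auto simp: phi edom_def)
  have xs_min': "real_of_ereal (f xs) + real_of_ereal (h xs) \<le> real_of_ereal (f u) + real_of_ereal (h u)"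
    if "u \<in> edom h" for u
    using xs_min[of u] by (simp add: fin that xs)
  have opt: "optimal_value \<phi> = \<phi> xs"
    unfolding optimal_value_def using xs_min by (intro antisym INF_lower INF_greatest) auto
  \<comment> \<open>The analysis runs with the true constants \<open>M\<^sub>s\<close> and
    \<open>D\<^sub>h\<close>; the estimates \<open>M\<close> and \<open>D\<close> enter only through
    \<open>\<theta>\<close> and \<open>R\<close>.\<close>
  interpret scpb_process P Q \<xi> f h s lam \<theta> M\<^sub>s D\<^sub>h K x0 xs cc S x y
  proof unfold_locales
    show "P.indep_vars (\<lambda>_. Q) \<xi> UNIV" "distr P Q (\<xi> j) = Q" for j
      using samples by (auto simp: iid_samples_def)
    show "(\<lambda>(x, z). s x z) \<in> borel_measurable (restrict_space borel (edom h) \<Otimes>\<^sub>M Q)"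
      using A2 by (simp add: stochastic_oracles_def)
    show "integrable Q (s u)" "(\<integral>z. s u z \<partial>Q) \<in> subdifferential f u" if "u \<in> edom h" for u
      using A2 that by (auto simp: stochastic_oracles_def)
    show "integrable Q (\<lambda>z. (norm (s u z))\<^sup>2)" if "u \<in> edom h" for u
      using A3(1) that by (auto simp: second_moment_bounded_def)
    show "(\<integral>z. (norm (s u z))\<^sup>2 \<partial>Q) \<le> M\<^sub>s\<^sup>2" if "u \<in> edom h" for u
      using second_moment_le_moment_bound(1)[OF A3(1) that] A3(2) by simp
    show "0 \<le> M\<^sub>s" using second_moment_le_moment_bound(2)[OF A3(1) xs] A3(2) by simp
    show "norm (u - v) \<le> D\<^sub>h" if "u \<in> edom h" "v \<in> edom h" for u v
      using diameter_bounded_bound[OF diam(1) that] diam(2) by (simp add: dist_norm)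
  qed (use A1 input \<theta> xs run' in auto)
  have yout_eq: "yout \<omega> = y_out \<omega>" if "\<omega> \<in> space P" for \<omega>
    unfolding yout y_out_def scpb_output_def using cc[OF that] by (auto intro!: sum.cong)
  have mem: "yout \<omega> \<in> edom h" if "\<omega> \<in> space P" for \<omega>
    using y_out_mem[OF that] yout_eq[OF that] by simp
  \<comment> \<open>The stopping test gives \<open>R / (lam * k)\<close>; with
    \<open>k > K / 2\<close> and \<open>2 * R = D / (3 * M)\<close> this is at most the stated
    value.\<close>
  have tail: "scpb_tau \<theta> K ^ (cc k - Suc (cc (k - 1))) \<le> D / (3 * M * lam * real K)"
    if "k \<in> {1..K}" "K < 2 * k" for k
  proof -
    have "scpb_tau \<theta> K ^ (cc k - Suc (cc (k - 1))) \<le> R / (lam * real k)"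
      using scpb1_cycle_length(2)[OF rule' input(1) \<theta> Rpos that(1)] input that by (simp add: field_simps)
    also have "\<dots> \<le> R / (lam * (real K / 2))"
      using input that Rpos by (intro divide_left_mono mult_left_mono mult_pos_pos) auto
    also have "\<dots> = D / (3 * M * lam * real K)" using input by (simp add: R field_simps)
    finally show ?thesis .
  qed
  have gap1: "integrable P (\<lambda>\<omega>. real_of_ereal (f (y_out \<omega>)) + real_of_ereal (h (y_out \<omega>)))"
    by (rule y_out_expected_gap(1)[OF xs_min' tail])
  have gap2: "(\<integral>\<omega>. real_of_ereal (f (y_out \<omega>)) + real_of_ereal (h (y_out \<omega>)) \<partial>P)
        - (real_of_ereal (f xs) + real_of_ereal (h xs))
      \<le> D\<^sub>h\<^sup>2 / (lam * real K) + 2 * (D / (3 * M * lam * real K)) * M\<^sub>s * D\<^sub>h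
        + 2 * lam * M\<^sub>s\<^sup>2 / (\<theta> * real K)"
    by (rule y_out_expected_gap(2)[OF xs_min' tail])
  have real_eq: "real_of_ereal (\<phi> (yout \<omega>)) = real_of_ereal (f (y_out \<omega>)) + real_of_ereal (h (y_out \<omega>))"
    if "\<omega> \<in> space P" for \<omega>
    using mem[OF that] by (simp add: yout_eq[OF that] fin)
  have int: "integrable P (\<lambda>\<omega>. real_of_ereal (\<phi> (yout \<omega>)))"
    by (rule Bochner_Integration.integrable_cong[OF refl real_eq, THEN iffD2]) (use gap1 in simp_all)
  have "(\<integral>\<omega>. real_of_ereal (\<phi> (yout \<omega>)) \<partial>P)
      = (\<integral>\<omega>. real_of_ereal (f (y_out \<omega>)) + real_of_ereal (h (y_out \<omega>)) \<partial>P)"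
    using real_eq by (rule Bochner_Integration.integral_cong[OF refl])
  then have "(\<integral>\<omega>. real_of_ereal (\<phi> (yout \<omega>)) \<partial>P) - real_of_ereal (optimal_value \<phi>)
      \<le> D\<^sub>h\<^sup>2 / (lam * real K) + 2 * (D / (3 * M * lam * real K)) * M\<^sub>s * D\<^sub>h
        + 2 * lam * M\<^sub>s\<^sup>2 / (\<theta> * real K)"
    using gap2 by (simp add: opt fin[OF xs])
  also have "\<dots> \<le> 3 * D\<^sup>2 / (2 * lam * real K) * (\<kappa>\<^sub>D + \<kappa>\<^sub>M)"
    unfolding theta kappa using input by (intro optimality_gap_constant) auto
  finally have a: "(\<integral>\<omega>. real_of_ereal (\<phi> (yout \<omega>)) \<partial>P) - real_of_ereal (optimal_value \<phi>)
      \<le> 3 * D\<^sup>2 / (2 * lam * real K) * (\<kappa>\<^sub>D + \<kappa>\<^sub>M)" .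
  \<comment> \<open>The iteration count is the same on all paths, so its expectation is the count
    itself.\<close>
  have cK: "integrable P (\<lambda>\<omega>. real (c K \<omega>))" "(\<integral>\<omega>. real (c K \<omega>) \<partial>P) = real (cc K)"
  proof -
    have eq: "real (c K \<omega>) = real (cc K)" if "\<omega> \<in> space P" for \<omega> using cc[OF that] by simp
    show "integrable P (\<lambda>\<omega>. real (c K \<omega>))"
      by (rule Bochner_Integration.integrable_cong[OF refl eq, THEN iffD2]) simp_all
    have "(\<integral>\<omega>. real (c K \<omega>) \<partial>P) = (\<integral>\<omega>. real (cc K) \<partial>P)"
      by (rule Bochner_Integration.integral_cong[OF refl eq])
    then show "(\<integral>\<omega>. real (c K \<omega>) \<partial>P) = real (cc K)" by (simp add: P.prob_space)
  qed
  define L where "L = ln0p (lam * real K / R)"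
  define A where "A = lam\<^sup>2 * M\<^sup>2 * (real K)\<^sup>2 / D\<^sup>2"
  have L: "0 \<le> L" by (simp add: L_def ln0p_def)
  \<comment> \<open>By the choice of \<open>\<theta>\<close>, \<open>\<theta> * K^2\<close> equals
    \<open>2 * A\<close>; this and the two extra iterations per cycle account for the absolute
    constant 2.\<close>
  have "real K * (\<theta> * real K) = 2 * A" by (simp add: A_def theta power2_eq_square)
  then have "real K * (2 + (\<theta> * real K + 1) * L) = 2 * real K + (2 * A + real K) * L"
    by (simp add: distrib_left distrib_right flip: mult.assoc)
  also have "\<dots> \<le> 2 * ((A + real K) * (1 + L))"
  proof -
    have "0 \<le> A" "0 \<le> real K * L" using L by (auto simp: A_def)
    then show ?thesis by (simp add: algebra_simps)
  qed
  finally have "(\<integral>\<omega>. real (c K \<omega>) \<partial>P)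
      \<le> 2 * ((lam\<^sup>2 * M\<^sup>2 * (real K)\<^sup>2 / D\<^sup>2 + real K) * (1 + ln0p (lam * real K / R)))"
    using scpb1_total_length[OF rule' cc0 input(1) \<theta> Rpos] cK(2) by (simp add: A_def L_def)
  moreover have "AE \<omega> in P. \<phi> (yout \<omega>) < \<infinity>"
    using mem by (intro AE_I2) (simp add: fin)
  ultimately show ?thesis using int a cK(1) by blast
qed

end
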